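(* Let $d\ge 1$, $p>2$, $x\in\mathbb{R}^d$, $R\in(0,1)$. There exists $\bar\epsilon\in(0,R)$ such that for all $\epsilon\in(0,\bar\epsilon)$ the quantity $\mathcal{A}_\epsilon[\varphi](x)$ is well defined for any bounded measurable function $\varphi$ in $B_R(x)$. Moreover, if $\varphi\in C^2(B_R(x))$, then $$\mathcal{A}_\epsilon[\varphi](x)=\varphi(x)+\frac{\epsilon^2}{2}\left(\Delta_p\varphi(x)\right)^{\frac1{p-1}}+\epsilon^2E(\epsilon,\varphi,x),$$ where the error term $E(\epsilon,\varphi,x)$ satisfies: (a) If $\varphi\in C^2(B_R(x))$, then $E(\epsilon,\varphi,x)=o_\epsilon(1)$ as $\epsilon\to0^+$. (b) If $\varphi\in C^3(B_R(x))$ and $\nabla\varphi(x)\neq0$, there exist constants $k_1=k_1(d,p)>0$, $k_2=k_2(d,p)>0$ such that $$|E(\epsilon,\varphi,x)|\le k_1\epsilon^{2-\frac4p}\|D^2\varphi\|_{L^\infty(B_{\bar\epsilon}(x))}+k_2\epsilon^{\frac{2}{3p-4}}\left(\|\nabla\varphi\|_{L^\infty(B_{\bar\epsilon}(x))}+\|D^3\varphi\|_{L^\infty(B_{\bar\epsilon}(x))}+\frac{|D^2\varphi(x)|^2}{|\nabla\varphi(x)|}\right).$$ (c) If $\varphi\in C^2(B_R(x))$, there exists a constant $k_3=k_3(d,p)>0$ such that $$|E(\epsilon,\varphi,x)|\le k_3\left(\|D^2\varphi\|_{L^\infty(B_{\bar\epsilon}(x))}^{\frac1{p-1}}|\nab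la\varphi(x)|^{\frac{p-2}{p-1}}+\epsilon^{2-\frac4p}\|D^2\varphi\|_{L^\infty(B_{\bar\epsilon}(x))}+\epsilon^{\frac{2}{3p-4}}|\nabla\varphi(x)|\right).$$
   Context: Signed powers: $(s)^q=\operatorname{sgn}(s)|s|^q$ for $s\in\mathbb{R}$, $q>0$. $B_r(x)$ is the ball of radius $r$ centered at $x$. The $p$-Laplacian is $\Delta_p\varphi=\nabla\cdot(|\nabla\varphi|^{p-2}\nabla\varphi)$, i.e. for $\varphi\in C^2$, $\Delta_p\varphi=|\nabla\varphi|^{p-2}\big(\Delta\varphi+(p-2)\langle D^2\varphi\frac{\nabla\varphi}{|\nabla\varphi|},\frac{\nabla\varphi}{|\nabla\varphi|}\rangle\big)$ where $\nabla\varphi\ne0$, and $\Delta_p\varphi=0$ where $\nabla\varphi=0$. Set $\alpha=\frac{p-2}{p-1}$, $\beta=\frac{p-2}{p+d}$, $\gamma=\sqrt{2(p+d)}$, $m(\epsilon)=\epsilon^{\frac{2(p-1)}{3p-4}}$, $M(\epsilon)=\epsilon^{-2+\frac2p}$. For $\rho>0$, $$M_\rho[\varphi](x)=\frac\beta2\Big(\sup_{B_{\gamma\rho}(x)}\varphi+\inf_{B_{\gamma\rho}(x)}\varphi\Big)+(1-\beta)\frac{1}{|B_{\gamma\rho}(x)|}\int_{B_{\gamma\rho}(x)}\varphi(y)\,dy,$$ and $$\mathcal{A}_\epsilon[\varphi](x)=\frac12\max\Big[\inf_{c\in[m(\epsilon),M(\epsilon)]}\Big\{\alpha\sup_{B_{\epsilon^2c^{1-\alpha}}(x)}\varphi+(1-\alpha)M_{\epsilon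 c^{-\alpha/2}}[\varphi](x)\Big\},\varphi(x)\Big]+\frac12\min\Big[\sup_{c\in[m(\epsilon),M(\epsilon)]}\Big\{\alpha\inf_{B_{\epsilon^2c^{1-\alpha}}(x)}\varphi+(1-\alpha)M_{\epsilon c^{-\alpha/2}}[\varphi](x)\Big\},\varphi(x)\Big].$$ "Well defined" means that all balls involved lie in $B_R(x)$, so that all suprema, infima and averages make sense.
   Formalization: In (b),(c) the norms are over B_r(x), for every r in [ε̄,R) such that B_r(x) contains all balls used by A_ε (r=ε̄ allowed once ε is small), instead of over B_ε̄(x) for all ε<ε̄; the printed form fails because the balls of A_ε can leave B_ε̄(x). *)

theory Defs
  imports "HOL-Probability.Essential_Supremum"
begin

section \<open>Signed powers, derivatives and norms\<close>

definition spow :: "real \<Rightarrow> real \<Rightarrow> real" where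
  "spow s q = sgn s * \<bar>s\<bar> powr q"

definition partial :: "'n \<Rightarrow> (real^'n::finite \<Rightarrow> real) \<Rightarrow> real^'n \<Rightarrow> real" where
  "partial i f y = frechet_derivative f (at y) (axis i 1)"

primrec Ck_on :: "nat \<Rightarrow> (real^'n::finite) set \<Rightarrow> (real^'n \<Rightarrow> real) \<Rightarrow> bool" where
  "Ck_on 0 S f = continuous_on S f"
| "Ck_on (Suc k) S f =
     ((\<forall>y\<in>S. f differentiable (at y)) \<and> (\<forall>i. Ck_on k S (partial i f)))"

definition grad :: "(real^'n::finite \<Rightarrow> real) \<Rightarrow> real^'n \<Rightarrow> real^'n" where
  "grad f y = (\<chi> i. partial i f y)"

definition D2 :: "(real^'n::finite \<Rightarrow> real) \<Rightarrow> real^'n \<Rightarrow> real^'n^'n" where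
  "D2 f y = (\<chi> i j. partial j (partial i f) y)"

definition D3 :: "(real^'n::finite \<Rightarrow> real) \<Rightarrow> real^'n \<Rightarrow> real^'n^'n^'n" where
  "D3 f y = (\<chi> i j k. partial k (partial j (partial i f)) y)"

text \<open>The pointwise norm is the Euclidean (Frobenius) norm of the vector, matrix or tensor
  \<open>F y\<close>. An infinite essential supremum is sent to \<open>0\<close> by \<open>real_of_ereal\<close>; this cannot happen
  when \<open>F\<close> is continuous on a neighbourhood of the closure of the bounded set \<open>S\<close>.\<close>

definition Linf_norm :: "(real^'n::finite) set \<Rightarrow> (real^'n \<Rightarrow> 'b::real_normed_vector) \<Rightarrow> real" where
  "Linf_norm S F = real_of_ereal (esssup (lebesgue_on S) (\<lambda>y. ereal (norm (F y))))"

section \<open>The p-Laplacian\<close>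

definition p_laplacian :: "real \<Rightarrow> (real^'n::finite \<Rightarrow> real) \<Rightarrow> real^'n \<Rightarrow> real" where
  "p_laplacian p f y =
     (\<Sum>i\<in>UNIV. partial i (\<lambda>z. norm (grad f z) powr (p - 2) * grad f z $ i) y)"

text \<open>For \<open>C\<^sup>2\<close> functions the divergence form agrees with the usual expanded expression, and it
  vanishes at critical points.\<close>

lemma Ck2D:
  assumes "Ck_on 2 S f" "y \<in> S"
  shows "f differentiable (at y)" "partial i f differentiable (at y)"
  using assms by (auto simp: numeral_2_eq_2)

lemma frechet_partial:
  fixes f :: "real^'n::finite \<Rightarrow> real"
  assumes "f differentiable (at y)"
  shows "frechet_derivative f (at y) h = (\<Sum>j\<in>UNIV. h $ j * partial j f y)"
proof -
  have l: "linear (frechet_derivative f (at y))"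
    using assms by (rule linear_frechet_derivative)
  have "frechet_derivative f (at y) h = frechet_derivative f (at y) (\<Sum>j\<in>UNIV. h $ j *\<^sub>R axis j 1)"
    by (simp add: basis_expansion scalar_mult_eq_scaleR[symmetric])
  also have "\<dots> = (\<Sum>j\<in>UNIV. h $ j *\<^sub>R frechet_derivative f (at y) (axis j 1))"
    using l by (simp add: linear_sum linear_scale)
  finally show ?thesis by (simp add: partial_def)
qed

lemma grad_has_derivative:
  assumes "Ck_on 2 S f" "y \<in> S"
  shows "(grad f has_derivative (\<lambda>h. D2 f y *v h)) (at y)"
proof -
  have "(partial i f has_derivative (\<lambda>h. (D2 f y *v h) $ i)) (at y)" for i
  proof -
    have d: "partial i f differentiable (at y)" using Ck2D assms by blast
    have "(\<lambda>h. (D2 f y *v h) $ i) = frechet_derivative (partial i f) (at y)"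
      by (auto simp: fun_eq_iff frechet_partial[OF d] D2_def matrix_vector_mult_def mult.commute)
    then show ?thesis using d frechet_derivative_works by metis
  qed
  then show ?thesis
    unfolding grad_def has_derivative_componentwise_within[where S=UNIV, of "\<lambda>y. \<chi> i. partial i f y"]
    by (auto simp: Basis_vec_def inner_axis)
qed

lemma partialI: "(f has_derivative f') (at y) \<Longrightarrow> partial i f y = f' (axis i 1)"
  unfolding partial_def using frechet_derivative_at by metis

lemma p_laplacian_grad_eq_0:
  assumes "2 < p" "Ck_on 2 S f" "y \<in> S" "grad f y = 0"
  shows "p_laplacian p f y = 0"
proof -
  have "((\<lambda>v::real^'a. norm v powr (p - 2) * v $ i) has_derivative (\<lambda>_. 0)) (at 0)" for i
  proof -
    have 1: "((\<lambda>v::real^'a. norm v powr (p - 2)) \<longlongrightarrow> 0) (at 0)"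
    proof -
      have "((\<lambda>v::real^'a. norm v powr (p - 2)) \<longlongrightarrow> norm (0::real^'a) powr (p - 2)) (at 0)"
        using assms(1) by (intro tendsto_intros tendsto_powr') (auto)
      then show ?thesis using assms(1) by simp
    qed
    show ?thesis
      unfolding has_derivative_at_within
    proof (intro conjI)
      show "((\<lambda>v::real^'a. (norm v powr (p - 2) * v $ i - norm (0::real^'a) powr (p - 2) * (0::real^'a) $ i - 0) /\<^sub>R norm (v - 0)) \<longlongrightarrow> 0) (at 0)"
        by (rule Lim_null_comparison[OF always_eventually 1])
          (auto simp: divide_simps abs_mult intro!: mult_left_mono component_le_norm_cart)
    qed auto
  qed
  then have "((\<lambda>z. norm (grad f z) powr (p - 2) * grad f z $ i) has_derivative (\<lambda>_. 0)) (at y)" for i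
    using has_derivative_compose[OF grad_has_derivative[OF assms(2,3)]] assms(4) by fastforce
  then show ?thesis unfolding p_laplacian_def by (intro sum.neutral ballI) (simp add: partialI[where f'="\<lambda>_. 0"])
qed

lemma p_laplacian_grad_neq_0:
  assumes "2 < p" "Ck_on 2 S f" "y \<in> S" "grad f y \<noteq> 0"
  shows "p_laplacian p f y = norm (grad f y) powr (p - 2) *
    (trace (D2 f y) + (p - 2) * ((D2 f y *v sgn (grad f y)) \<bullet> sgn (grad f y)))"
proof -
  let ?g = "grad f y" and ?H = "D2 f y"
  note d = grad_has_derivative[OF assms(2,3)]
  have n: "((\<lambda>z. norm (grad f z)) has_derivative (\<lambda>h. (?H *v h) \<bullet> sgn ?g)) (at y)"
    by (rule has_derivative_compose[OF d]) (rule has_derivative_norm[OF assms(4)])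
  have c: "((\<lambda>z. grad f z $ i) has_derivative (\<lambda>h. (?H *v h) $ i)) (at y)" for i
    by (rule bounded_linear.has_derivative[OF bounded_linear_vec_nth d])
  have w: "((\<lambda>z. norm (grad f z) powr (p - 2)) has_derivative
      (\<lambda>h. (p - 2) * norm ?g powr (p - 3) * ((?H *v h) \<bullet> sgn ?g))) (at y)"
    using has_derivative_powr[OF n has_derivative_const[of "p-2"]] assms(4)
    by (simp add: powr_diff field_simps power3_eq_cube numeral_eq_Suc powr_realpow) 
  have "partial i (\<lambda>z. norm (grad f z) powr (p - 2) * grad f z $ i) y =
     norm ?g powr (p - 2) * (?H $ i $ i) + (p - 2) * norm ?g powr (p - 3) * ((?H *v axis i 1) \<bullet> sgn ?g) * ?g $ i" for i
    using partialI[OF has_derivative_mult[OF w c], of i]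
    by (simp add: matrix_vector_mult_basis column_def)
  then have "p_laplacian p f y = norm ?g powr (p - 2) * trace ?H
     + (p - 2) * norm ?g powr (p - 3) * (\<Sum>i\<in>UNIV. ?g $ i * ((?H *v axis i 1) \<bullet> sgn ?g))"
    unfolding p_laplacian_def by (simp only: sum.distrib sum_distrib_left trace_def mult.assoc) (simp add: mult.commute)
  also have "(\<Sum>i\<in>UNIV. ?g $ i * ((?H *v axis i 1) \<bullet> sgn ?g)) = (?H *v ?g) \<bullet> sgn ?g"
    by (subst matrix_mult_sum) (simp add: inner_sum_left matrix_vector_mult_basis scalar_mult_eq_scaleR)
  also have "\<dots> = norm ?g * ((?H *v sgn ?g) \<bullet> sgn ?g)"
    using assms(4) by (simp add: sgn_div_norm matrix_vector_mult_scaleR)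
  finally have eq: "p_laplacian p f y = norm ?g powr (p - 2) * trace ?H
     + (p - 2) * norm ?g powr (p - 3) * (norm ?g * ((?H *v sgn ?g) \<bullet> sgn ?g))" .
  have e: "norm ?g powr (p - 2) = norm ?g powr (p - 3) * norm ?g"
    using assms(4) powr_mult_base[of "norm ?g" "p - 3"] by (simp add: mult.commute)
  show ?thesis
    unfolding eq e by (simp add: algebra_simps)
qed

section \<open>The nonlinear averaging operator\<close>

definition alpha :: "real \<Rightarrow> real" where
  "alpha p = (p - 2) / (p - 1)"

definition beta :: "real \<Rightarrow> nat \<Rightarrow> real" where
  "beta p d = (p - 2) / (p + real d)"

definition gamma :: "real \<Rightarrow> nat \<Rightarrow> real" where
  "gamma p d = sqrt (2 * (p + real d))"

definition m_eps :: "real \<Rightarrow> real \<Rightarrow> real" where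
  "m_eps p \<epsilon> = \<epsilon> powr (2 * (p - 1) / (3 * p - 4))"

definition M_eps :: "real \<Rightarrow> real \<Rightarrow> real" where
  "M_eps p \<epsilon> = \<epsilon> powr (- 2 + 2 / p)"

definition ball_avg :: "real \<Rightarrow> (real^'n::finite \<Rightarrow> real) \<Rightarrow> real^'n \<Rightarrow> real" where
  "ball_avg r f x =
     1 / measure lebesgue (ball x r) * set_lebesgue_integral lebesgue (ball x r) f"

definition M_op :: "real \<Rightarrow> real \<Rightarrow> (real^'n::finite \<Rightarrow> real) \<Rightarrow> real^'n \<Rightarrow> real" where
  "M_op p \<rho> f x =
     (let \<beta> = beta p CARD('n); r = gamma p CARD('n) * \<rho> in
      \<beta> / 2 * ((SUP y\<in>ball x r. f y) + (INF y\<in>ball x r. f y)) + (1 - \<beta>) * ball_avg r f x)"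

definition rad1 :: "real \<Rightarrow> real \<Rightarrow> real \<Rightarrow> real" where
  "rad1 p \<epsilon> c = \<epsilon>\<^sup>2 * c powr (1 - alpha p)"

definition rad2 :: "real \<Rightarrow> real \<Rightarrow> real \<Rightarrow> real" where
  "rad2 p \<epsilon> c = \<epsilon> * c powr (- alpha p / 2)"

definition up_term :: "real \<Rightarrow> real \<Rightarrow> (real^'n::finite \<Rightarrow> real) \<Rightarrow> real^'n \<Rightarrow> real \<Rightarrow> real" where
  "up_term p \<epsilon> f x c =
     alpha p * (SUP y\<in>ball x (rad1 p \<epsilon> c). f y) + (1 - alpha p) * M_op p (rad2 p \<epsilon> c) f x"

definition down_term :: "real \<Rightarrow> real \<Rightarrow> (real^'n::finite \<Rightarrow> real) \<Rightarrow> real^'n \<Rightarrow> real \<Rightarrow> real" where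
  "down_term p \<epsilon> f x c =
     alpha p * (INF y\<in>ball x (rad1 p \<epsilon> c). f y) + (1 - alpha p) * M_op p (rad2 p \<epsilon> c) f x"

definition A_op :: "real \<Rightarrow> real \<Rightarrow> (real^'n::finite \<Rightarrow> real) \<Rightarrow> real^'n \<Rightarrow> real" where
  "A_op p \<epsilon> f x =
     1 / 2 * max (INF c\<in>{m_eps p \<epsilon>..M_eps p \<epsilon>}. up_term p \<epsilon> f x c) (f x)
   + 1 / 2 * min (SUP c\<in>{m_eps p \<epsilon>..M_eps p \<epsilon>}. down_term p \<epsilon> f x c) (f x)"

definition balls_inside :: "real \<Rightarrow> real \<Rightarrow> real^'n::finite \<Rightarrow> real \<Rightarrow> bool" where
  "balls_inside p \<epsilon> x r \<longleftrightarrow>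
     (\<forall>c\<in>{m_eps p \<epsilon>..M_eps p \<epsilon>}.
        ball x (rad1 p \<epsilon> c) \<subseteq> ball x r \<and>
        ball x (gamma p CARD('n) * rad2 p \<epsilon> c) \<subseteq> ball x r)"

text \<open>All balls involved lie in \<open>ball x R\<close>, and every supremum, infimum and average in
  \<open>A_op\<close> is that of a nonempty bounded set, respectively of an integrable function, so that none
  of them takes an unspecified default value.\<close>

definition A_well_defined :: "real \<Rightarrow> real \<Rightarrow> (real^'n::finite \<Rightarrow> real) \<Rightarrow> real^'n \<Rightarrow> real \<Rightarrow> bool" where
  "A_well_defined p \<epsilon> f x R \<longleftrightarrow>
     m_eps p \<epsilon> \<le> M_eps p \<epsilon> \<and>
     balls_inside p \<epsilon> x R \<and>
     (\<forall>c\<in>{m_eps p \<epsilon>..M_eps p \<epsilon>}.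
        0 < rad1 p \<epsilon> c \<and> 0 < gamma p CARD('n) * rad2 p \<epsilon> c \<and>
        bounded (f ` ball x (rad1 p \<epsilon> c)) \<and>
        bounded (f ` ball x (gamma p CARD('n) * rad2 p \<epsilon> c)) \<and>
        set_integrable lebesgue (ball x (gamma p CARD('n) * rad2 p \<epsilon> c)) f) \<and>
     bdd_below (up_term p \<epsilon> f x ` {m_eps p \<epsilon>..M_eps p \<epsilon>}) \<and>
     bdd_above (down_term p \<epsilon> f x ` {m_eps p \<epsilon>..M_eps p \<epsilon>})"

end

theory Submission
  imports Defs
begin

text \<open>
  Since \<open>inf \<phi> = - sup (- \<phi>)\<close>, the lower half of \<open>A_op\<close> is the upper half for \<open>- \<phi>\<close>, so only
  the excess of \<open>max (inf\<^sub>c up_term) \<phi>\<close> over \<open>\<phi>\<close> has to be expanded. Put \<open>G = \<bar>grad \<phi> x\<bar>\<close> and let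
  \<open>N\<close> be the normalized p-Laplacian. Taylor expansion and the second moments of a ball
  give \<open>up_term - \<phi> = \<epsilon>\<^sup>2 (\<alpha> c\<^sup>1\<^sup>-\<^sup>\<alpha> G + (1 - \<alpha>) c\<^sup>-\<^sup>\<alpha> N)\<close> up to errors. By the weighted AM-GM inequality the
  infimum over all \<open>c > 0\<close> of the bracket is \<open>N\<^sup>1\<^sup>-\<^sup>\<alpha> G\<^sup>\<alpha>\<close>, attained at \<open>c = N / G\<close>, when \<open>N > 0\<close>; when
  \<open>N \<le> 0\<close> its positive part is \<open>0\<close>. Restricting \<open>c\<close> to \<open>[m, M]\<close> costs at most \<open>m\<^sup>1\<^sup>-\<^sup>\<alpha> G + M\<^sup>-\<^sup>\<alpha> max 0 N\<close>.
  The three error estimates use the same bound on \<open>A_op\<close> with three expansions of the averages: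
  second order with a small error absorbed into \<open>N\<close> for the limit, third order for \<open>C\<^sup>3\<close> functions,
  and first order, with \<open>N\<close> replaced by a multiple of \<open>\<parallel>D2 \<phi>\<parallel>\<close>, for the crude bound.
\<close>

section \<open>Second moments of a ball\<close>

text \<open>The obstacle is that the errors are not uniform in \<open>c\<close>. The squared
  averaging radius is \<open>\<epsilon>\<^sup>2 * c powr (- alpha p)\<close>, and \<open>c\<close>
  may be as small as \<open>m_eps p \<epsilon>\<close>, so a small multiple of it need not be small
  compared with \<open>\<epsilon>\<^sup>2\<close>. For a C^2 function nothing better is available;
  the error has to move N to a nearby value, and continuity of the optimal value in N, which near N
  = 0 is only of Hoelder type, gives the limit without a rate. With three derivatives the error
  carries the cube of the radius, which is affordable: \<open>m_eps\<close> balances this cube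
  against the cost of cutting \<open>c\<close> off from below, and \<open>M_eps\<close> balances the
  squared radius of the sup and inf balls against the cost of cutting it off from above. The
  quotient of the squared Hessian norm by the gradient norm comes from replacing the extremal point
  of a linear plus quadratic function by the gradient direction. This is useless at critical points,
  where the whole quadratic part is counted as an error instead.\<close>

lemma lborel_distr_permute:
  fixes \<pi> :: "'n::finite \<Rightarrow> 'n"
  assumes "bij \<pi>"
  shows "distr lborel borel (\<lambda>x::real^'n. \<chi> i. x $ \<pi> i) = lborel"
proof (rule lborel_eqI[symmetric])
  let ?T = "\<lambda>x::real^'n. \<chi> i. x $ \<pi> i"
  have meas [measurable]: "?T \<in> borel_measurable borel"
    by (intro borel_measurable_continuous_onI continuous_intros)
  fix l u :: "real^'n"
  assume le: "\<And>b. b \<in> Basis \<Longrightarrow> l \<bullet> b \<le> u \<bullet> b"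
  define l' u' where "l' = (\<chi> i. l $ inv \<pi> i)" and "u' = (\<chi> i. u $ inv \<pi> i)"
  have le': "l $ i \<le> u $ i" for i
    using le[of "axis i 1"] by (simp add: inner_axis)
  have pre: "?T -` box l u = box l' u'"
  proof -
    have "(\<forall>i. l $ i < x $ \<pi> i \<and> x $ \<pi> i < u $ i) \<longleftrightarrow>
      (\<forall>i. l $ inv \<pi> i < x $ i \<and> x $ i < u $ inv \<pi> i)" for x :: "real^'n"
      using assms by (metis bij_inv_eq_iff)
    then show ?thesis by (auto simp: mem_box_cart l'_def u'_def)
  qed
  have pr: "(\<Prod>b\<in>Basis. (v - w) \<bullet> b) = (\<Prod>i\<in>UNIV. v $ i - w $ i)" for v w :: "real^'n"
  proof -
    have "Basis = (\<lambda>i. axis i 1 :: real^'n) ` UNIV" by (auto simp: Basis_vec_def)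
    moreover have "inj (\<lambda>i. axis i 1 :: real^'n)" by (auto simp: inj_on_def axis_eq_axis)
    ultimately show ?thesis
      using prod.reindex[of "\<lambda>i. axis i 1 :: real^'n" UNIV "\<lambda>b. (v - w) \<bullet> b"]
      by (simp add: inner_axis)
  qed
  have "emeasure (distr lborel borel ?T) (box l u) = emeasure lborel (box l' u')"
    by (subst emeasure_distr) (auto simp: pre)
  also have "\<dots> = (\<Prod>b\<in>Basis. (u' - l') \<bullet> b)"
    using le' by (intro emeasure_lborel_box) (auto simp: Basis_vec_def inner_axis l'_def u'_def)
  also have "(\<Prod>b\<in>Basis. (u' - l') \<bullet> b) = (\<Prod>b\<in>Basis. (u - l) \<bullet> b)"
    unfolding pr l'_def u'_def
    by (simp, rule prod.reindex_bij_betw[OF bij_imp_bij_inv[OF assms]])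
  finally show "emeasure (distr lborel borel ?T) (box l u) = (\<Prod>b\<in>Basis. (u - l) \<bullet> b)" .
qed simp

text \<open>Reflections will kill the odd and mixed moments of a ball, and coordinate permutations
  will make its diagonal second moments equal. A reflection is a diagonal map with entries 1 and -1,
  so its Jacobian factor is 1.\<close>

lemma lborel_distr_reflect:
  "distr lborel borel (\<lambda>x::real^'n::finite. \<chi> i. if i = k then - x $ i else x $ i) = lborel"
proof -
  define c :: "real^'n \<Rightarrow> real" where "c = (\<lambda>j. if j = axis k 1 then - 1 else 1)"
  have T: "(\<chi> i. if i = k then - x $ i else x $ i) = 0 + (\<Sum>j\<in>Basis. (c j * (x \<bullet> j)) *\<^sub>R j)"
    for x :: "real^'n"
  proof -
    have B: "Basis = (\<lambda>i. axis i 1 :: real^'n) ` UNIV" by (auto simp: Basis_vec_def)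
    have inj: "inj (\<lambda>i. axis i 1 :: real^'n)" by (auto simp: inj_on_def axis_eq_axis)
    have c: "c (axis i 1) = (if i = k then - 1 else 1)" for i
      by (simp add: c_def axis_eq_axis)
    have "(\<Sum>j\<in>Basis. (c j * (x \<bullet> j)) *\<^sub>R j) =
      (\<Sum>i\<in>UNIV. (if i = k then - x $ i else x $ i) *\<^sub>R axis i 1)"
      unfolding B sum.reindex[OF inj] by (auto intro!: sum.cong simp: c inner_axis)
    also have "\<dots> = (\<chi> i. if i = k then - x $ i else x $ i)"
      using basis_expansion[of "\<chi> i. if i = k then - x $ i else x $ i"]
      by (simp add: scalar_mult_eq_scaleR)
    finally show ?thesis by simp
  qed
  have "lborel = density (distr lborel borel (\<lambda>x. 0 + (\<Sum>j\<in>Basis. (c j * (x \<bullet> j)) *\<^sub>R j)))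
    (\<lambda>_. (\<Prod>j\<in>Basis. \<bar>c j\<bar>))"
    by (rule lborel_affine_euclidean) (auto simp: c_def)
  moreover have "(\<Prod>j\<in>Basis. \<bar>c j\<bar>) = 1" by (intro prod.neutral) (auto simp: c_def)
  ultimately show ?thesis by (simp add: T density_1)
qed

section \<open>Change of variables in integrals over symmetric or rescaled sets\<close>

lemma set_lebesgue_integral_permute:
  fixes \<pi> :: "'n::finite \<Rightarrow> 'n" and f :: "real^'n \<Rightarrow> real"
  assumes "bij \<pi>" "f \<in> borel_measurable borel" "A \<in> sets borel"
    "\<And>x. (\<chi> i. x $ \<pi> i) \<in> A \<longleftrightarrow> x \<in> A"
  shows "(LINT x:A|lborel. f (\<chi> i. x $ \<pi> i)) = (LINT x:A|lborel. f x)"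
proof -
  note [measurable] = assms(2,3)
  have [measurable]: "(\<lambda>x::real^'n. \<chi> i. x $ \<pi> i) \<in> borel_measurable borel"
    by (intro borel_measurable_continuous_onI continuous_intros)
  have "(LINT x:A|lborel. f x) = (LINT x:A|distr lborel borel (\<lambda>x. \<chi> i. x $ \<pi> i). f x)"
    by (simp add: lborel_distr_permute[OF assms(1)])
  also have "\<dots> = (LINT x:A|lborel. f (\<chi> i. x $ \<pi> i))"
    unfolding set_lebesgue_integral_def
    by (subst integral_distr) (auto simp: indicator_def assms(4))
  finally show ?thesis ..
qed

lemma set_lebesgue_integral_reflect:
  fixes f :: "real^'n::finite \<Rightarrow> real"
  assumes "f \<in> borel_measurable borel" "A \<in> sets borel"
    "\<And>x. (\<chi> i. if i = k then - x $ i else x $ i) \<in> A \<longleftrightarrow> x \<in> A"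
  shows "(LINT x:A|lborel. f (\<chi> i. if i = k then - x $ i else x $ i)) = (LINT x:A|lborel. f x)"
proof -
  note [measurable] = assms(1,2)
  let ?T = "\<lambda>x::real^'n. \<chi> i. if i = k then - x $ i else x $ i"
  have "continuous_on UNIV (\<lambda>x::real^'n. if i = k then - x $ i else x $ i)" for i
    by (cases "i = k") (auto intro!: continuous_intros)
  then have [measurable]: "?T \<in> borel_measurable borel"
    by (intro borel_measurable_continuous_onI continuous_on_vec_lambda)
  have "(LINT x:A|lborel. f x) = (LINT x:A|distr lborel borel ?T. f x)"
    by (simp add: lborel_distr_reflect)
  also have "\<dots> = (LINT x:A|lborel. f (?T x))"
    unfolding set_lebesgue_integral_def
    by (subst integral_distr) (auto simp: indicator_def assms(3))
  finally show ?thesis ..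
qed

lemma set_lebesgue_integral_affine:
  fixes f :: "'a::euclidean_space \<Rightarrow> real"
  assumes c: "0 < c" and [measurable]: "f \<in> borel_measurable borel" "A \<in> sets borel"
    and int: "set_integrable lborel A f"
  shows "(LINT x:A|lborel. f x) = c ^ DIM('a) * (LINT x:{x. t + c *\<^sub>R x \<in> A}|lborel. f (t + c *\<^sub>R x))"
proof -
  have ind: "indicator A (t + c *\<^sub>R x) = (indicator {x. t + c *\<^sub>R x \<in> A} x :: real)" for x
    by (auto simp: indicator_def)
  have "(LINT x:A|lborel. f x) = (LINT x:A|density (distr lborel borel (\<lambda>x. t + c *\<^sub>R x)) (\<lambda>_. ennreal (\<bar>c\<bar>^DIM('a))). f x)"
    using lborel_affine[of c t] c by (simp add: ennreal_power)
  also have "\<dots> = c ^ DIM('a) * (LINT x:{x. t + c *\<^sub>R x \<in> A}|lborel. f (t + c *\<^sub>R x))"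
    unfolding set_lebesgue_integral_def using c
    by (subst integral_density; simp?) (subst integral_distr; simp add: ind)
  finally show ?thesis .
qed

lemma set_integrable_continuous_ball:
  fixes f :: "'a::euclidean_space \<Rightarrow> real"
  assumes "continuous_on UNIV f"
  shows "set_integrable lborel (ball x s) f"
proof -
  have "set_integrable lborel (cball x s) f"
    unfolding set_integrable_def
    by (rule borel_integrable_compact) (auto intro: continuous_on_subset[OF assms])
  then show ?thesis by (rule set_integrable_subset) auto
qed

lemma set_lebesgue_integral_sum:
  fixes f :: "'i \<Rightarrow> 'a \<Rightarrow> real"
  assumes "\<And>i. i \<in> I \<Longrightarrow> set_integrable M S (f i)"
  shows "(LINT x:S|M. \<Sum>i\<in>I. f i x) = (\<Sum>i\<in>I. LINT x:S|M. f i x)"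
  using assms unfolding set_integrable_def set_lebesgue_integral_def scaleR_sum_right
  by (rule Bochner_Integration.integral_sum)

text \<open>Scaling expresses the integral over the shell between the radii \<open>u s\<close> and \<open>s\<close> through the
  integral over the whole ball; on the shell the integrand is squeezed between \<open>(u s)\<^sup>2\<close> and \<open>s\<^sup>2\<close>,
  and \<open>u \<longrightarrow> 1\<close> gives the value.\<close>

lemma integral_ball_norm_square:
  assumes s: "0 < s"
  shows "(LINT h:ball (0::'a::euclidean_space) s|lborel. (norm h)\<^sup>2) * (DIM('a) + 2)
    = s\<^sup>2 * measure lborel (ball (0::'a) s) * DIM('a)"
proof -
  let ?d = "DIM('a)"
  define I where "I = (LINT h:ball (0::'a) s|lborel. (norm h)\<^sup>2)"
  define V where "V = measure lborel (ball (0::'a) s)"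
  \<comment> \<open>\<open>S n u\<close> is (1 - u^n) / (1 - u) in polynomial form. Both shell
    integrals contain the factor 1 - u; once it is cancelled, the limit u -> 1 can be taken, where
    \<open>S n\<close> tends to n. This produces the numbers d and d + 2.\<close>
  define S :: "nat \<Rightarrow> real \<Rightarrow> real" where "S n u = (\<Sum>k<n. u ^ k)" for n u
  have Sn: "1 - u ^ n = (1 - u) * S n u" for n u
    unfolding S_def by (rule one_diff_power_eq)
  have key: "s\<^sup>2 * u\<^sup>2 * V * S ?d u \<le> I * S (?d + 2) u \<and> I * S (?d + 2) u \<le> s\<^sup>2 * V * S ?d u"
    if u: "0 < u" "u < 1" for u
  proof -
    have less: "u * s < s" using u s by simp
    have sc: "{h. 0 + u *\<^sub>R h \<in> ball (0::'a) (u * s)} = ball 0 s"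
      using u by (auto simp: dist_norm)
    have ci: "set_integrable lborel (ball (0::'a) t) (\<lambda>h. (norm h)\<^sup>2)" for t
      by (intro set_integrable_continuous_ball continuous_intros)
    have c1: "set_integrable lborel (ball (0::'a) t) (\<lambda>h. 1::real)" for t
      by (intro set_integrable_continuous_ball continuous_intros)
    have V1: "(LINT h:ball (0::'a) t|lborel. 1) = measure lborel (ball (0::'a) t)" for t
      by (simp add: set_lebesgue_integral_def)
    have I1: "(LINT h:ball (0::'a) (u * s)|lborel. (norm h)\<^sup>2) = u ^ ?d * (u\<^sup>2 * I)"
      using set_lebesgue_integral_affine[OF u(1) _ _ ci[of "u * s"], where t=0]
      by (simp add: sc[simplified] I_def power_mult_distrib)
    have V2: "measure lborel (ball (0::'a) (u * s)) = u ^ ?d * V"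
      using set_lebesgue_integral_affine[OF u(1) _ _ c1[of "u * s"], where t=0]
      by (simp only: sc V1) (simp add: V_def)
    let ?Sh = "ball (0::'a) s - ball 0 (u * s)"
    have sub: "ball (0::'a) s = ball 0 (u * s) \<union> ?Sh" using less by auto
    have shi: "set_integrable lborel ?Sh (\<lambda>h. (norm h)\<^sup>2)" "set_integrable lborel ?Sh (\<lambda>h. 1::real)"
      by (rule set_integrable_subset[OF ci[of s]] set_integrable_subset[OF c1[of s]]; auto)+
    have "I = u ^ ?d * (u\<^sup>2 * I) + (LINT h:?Sh|lborel. (norm h)\<^sup>2)"
      unfolding I1[symmetric] unfolding I_def
      by (subst sub, rule set_integral_Un) (use ci shi in auto)
    then have I: "(LINT h:?Sh|lborel. (norm h)\<^sup>2) = (1 - u ^ (?d + 2)) * I"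
      by (simp add: algebra_simps power_add power2_eq_square)
    have "V = u ^ ?d * V + (LINT h:?Sh|lborel. 1)"
      unfolding V2[symmetric] unfolding V_def V1[symmetric]
      by (subst sub, rule set_integral_Un) (use c1 shi in auto)
    then have V: "(LINT h:?Sh|lborel. 1) = (1 - u ^ ?d) * V"
      by (simp add: algebra_simps)
    have "(LINT h:?Sh|lborel. (norm h)\<^sup>2) \<le> (LINT h:?Sh|lborel. s\<^sup>2 * 1)"
      by (intro set_integral_mono shi set_integrable_mult_right)
        (auto intro!: power_mono)
    moreover have "(LINT h:?Sh|lborel. (u * s)\<^sup>2 * 1) \<le> (LINT h:?Sh|lborel. (norm h)\<^sup>2)"
      using s u by (intro set_integral_mono shi set_integrable_mult_right)
        (auto intro!: power_mono)
    ultimately have "(1 - u) * (I * S (?d + 2) u) \<le> (1 - u) * (s\<^sup>2 * V * S ?d u)"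
      "(1 - u) * (s\<^sup>2 * u\<^sup>2 * V * S ?d u) \<le> (1 - u) * (I * S (?d + 2) u)"
      unfolding set_integral_mult_right I V Sn by (auto simp: algebra_simps power_mult_distrib)
    then show ?thesis using u by auto
  qed
  have lim: "(S n \<longlongrightarrow> real n) (at_left 1)" for n
  proof -
    have "(S n \<longlongrightarrow> S n 1) (at_left 1)" unfolding S_def by (intro tendsto_intros)
    then show ?thesis by (simp add: S_def)
  qed
  have ev: "\<forall>\<^sub>F u in at_left (1::real). 0 < u \<and> u < 1"
    using eventually_at_left_real[of 0 1] by (auto elim: eventually_mono)
  have "\<forall>\<^sub>F u in at_left 1. I * S (?d + 2) u \<le> s\<^sup>2 * V * S ?d u"
    using ev by eventually_elim (use key in blast)
  then have "I * real (?d + 2) \<le> s\<^sup>2 * V * ?d"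
    by (rule tendsto_le[OF _ tendsto_mult_left[OF lim] tendsto_mult_left[OF lim], rotated]) simp
  moreover have "\<forall>\<^sub>F u in at_left 1. s\<^sup>2 * u\<^sup>2 * V * S ?d u \<le> I * S (?d + 2) u"
    using ev by eventually_elim (use key in blast)
  then have "s\<^sup>2 * 1\<^sup>2 * V * ?d \<le> I * real (?d + 2)"
    by (rule tendsto_le[OF _ tendsto_mult_left[OF lim] tendsto_mult[OF tendsto_mult_right[OF
      tendsto_mult_left[OF tendsto_power[OF tendsto_ident_at]]] lim], rotated]) simp
  ultimately show ?thesis by (simp add: I_def V_def)
qed

text \<open>Reflecting coordinate \<open>i\<close> changes the sign of the first two integrands, so
  these integrals vanish. Transpositions make all diagonal moments equal, and their sum is the
  integral of the squared norm.\<close>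

lemma ball_moments:
  fixes i j :: "'n::finite"
  assumes s: "0 < s"
  shows "(LINT h:ball (0::real^'n) s|lborel. h $ i) = 0"
    and "i \<noteq> j \<Longrightarrow> (LINT h:ball (0::real^'n) s|lborel. h $ i * h $ j) = 0"
    and "(LINT h:ball (0::real^'n) s|lborel. h $ i * h $ i) =
      s\<^sup>2 / (CARD('n) + 2) * measure lborel (ball (0::real^'n) s)"
proof -
  let ?B = "ball (0::real^'n) s"
  have ref: "(\<chi> l. if l = k then - x $ l else x $ l) \<in> ?B \<longleftrightarrow> x \<in> ?B" for k and x :: "real^'n"
  proof -
    have "norm (\<chi> l. if l = k then - x $ l else x $ l) = norm x"
      unfolding norm_vec_def by (intro L2_set_cong) auto
    then show ?thesis by simp
  qed
  have perm: "(\<chi> l. x $ \<pi> l) \<in> ?B \<longleftrightarrow> x \<in> ?B" if "bij \<pi>" for \<pi> and x :: "real^'n"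
  proof -
    have "norm (\<chi> l. x $ \<pi> l) = norm x"
      using sum.reindex_bij_betw[OF that, of "\<lambda>i. (x $ i)\<^sup>2"]
      unfolding norm_vec_def L2_set_def by simp
    then show ?thesis by simp
  qed
  have m: "(\<lambda>h::real^'n. h $ k) \<in> borel_measurable borel"
    "(\<lambda>h::real^'n. h $ k * h $ l) \<in> borel_measurable borel" for k l
    by (intro borel_measurable_continuous_onI continuous_intros)+
  have B: "?B \<in> sets borel" by simp
  have "(LINT h:?B|lborel. - h $ i) = (LINT h:?B|lborel. h $ i)"
    using set_lebesgue_integral_reflect[OF m(1) B ref, of i i] by simp
  then show "(LINT h:?B|lborel. h $ i) = 0" by (simp add: set_lebesgue_integral_def)
  show "(LINT h:?B|lborel. h $ i * h $ j) = 0" if "i \<noteq> j"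
  proof -
    have "(LINT h:?B|lborel. - (h $ i * h $ j)) = (LINT h:?B|lborel. h $ i * h $ j)"
      using set_lebesgue_integral_reflect[OF m(2) B ref, of i i j] that by simp
    then show ?thesis by (simp add: set_lebesgue_integral_def)
  qed
  have eq: "(LINT h:?B|lborel. h $ k * h $ k) = (LINT h:?B|lborel. h $ i * h $ i)" for k
    using set_lebesgue_integral_permute[OF _ m(2) B perm, of "Transposition.transpose i k" i i] by simp
  have "(LINT h:?B|lborel. (norm h)\<^sup>2) = (LINT h:?B|lborel. \<Sum>k\<in>UNIV. h $ k * h $ k)"
    by (simp add: power2_norm_eq_inner inner_vec_def)
  also have "\<dots> = (\<Sum>k\<in>UNIV. LINT h:?B|lborel. h $ k * h $ k)"
    by (rule set_lebesgue_integral_sum) (intro set_integrable_continuous_ball continuous_intros)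
  also have "\<dots> = (\<Sum>k::'n\<in>UNIV. LINT h:?B|lborel. h $ i * h $ i)"
    by (rule sum.cong[OF refl eq])
  also have "\<dots> = CARD('n) * (LINT h:?B|lborel. h $ i * h $ i)"
    by simp
  finally show "(LINT h:?B|lborel. h $ i * h $ i) =
      s\<^sup>2 / (CARD('n) + 2) * measure lborel ?B"
    using integral_ball_norm_square[OF s, where 'a="real^'n"]
    by (subst mult_left_cancel[of "real CARD('n)", symmetric]) (auto simp: field_simps)
qed

lemma continuous_on_matrix_form:
  fixes A :: "real^'n::finite^'n"
  shows "continuous_on S (\<lambda>y. y \<bullet> (A *v y))"
  unfolding inner_vec_def matrix_vector_mult_def
  by (simp, intro continuous_intros)

lemma integral_ball_matrix_form:
  fixes A :: "real^'n::finite^'n"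
  assumes s: "0 < s"
  shows "(LINT h:ball 0 s|lborel. h \<bullet> (A *v h)) =
    s\<^sup>2 / (CARD('n) + 2) * trace A * measure lborel (ball (0::real^'n) s)"
proof -
  let ?B = "ball (0::real^'n) s"
  have int: "set_integrable lborel ?B (\<lambda>h. A $ i $ j * (h $ i * h $ j))"
      "set_integrable lborel ?B (\<lambda>h. \<Sum>j\<in>UNIV. A $ i $ j * (h $ i * h $ j))" for i j
    by (intro set_integrable_continuous_ball continuous_intros)+
  have "(LINT h:?B|lborel. h \<bullet> (A *v h)) =
    (LINT h:?B|lborel. \<Sum>i\<in>UNIV. \<Sum>j\<in>UNIV. A $ i $ j * (h $ i * h $ j))"
    by (simp add: inner_vec_def matrix_vector_mult_def sum_distrib_left mult_ac)
  also have "\<dots> = (\<Sum>i\<in>UNIV. \<Sum>j\<in>UNIV. A $ i $ j * (LINT h:?B|lborel. h $ i * h $ j))"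
    unfolding set_integral_mult_right[symmetric]
    by (subst set_lebesgue_integral_sum[OF int(2)])
      (intro sum.cong refl set_lebesgue_integral_sum int(1))
  also have "\<dots> = (\<Sum>i\<in>UNIV. A $ i $ i * (LINT h:?B|lborel. h $ i * h $ i))"
  proof (intro sum.cong refl)
    fix i :: 'n
    have "(\<Sum>j\<in>UNIV. A $ i $ j * (LINT h:?B|lborel. h $ i * h $ j)) =
      (\<Sum>j\<in>{i}. A $ i $ j * (LINT h:?B|lborel. h $ i * h $ j))"
      by (intro sum.mono_neutral_right) (auto simp: ball_moments(2)[OF s])
    then show "(\<Sum>j\<in>UNIV. A $ i $ j * (LINT h:?B|lborel. h $ i * h $ j)) =
      A $ i $ i * (LINT h:?B|lborel. h $ i * h $ i)" by simp
  qed
  also have "\<dots> = s\<^sup>2 / (CARD('n) + 2) * trace A * measure lborel ?B"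
    unfolding ball_moments(3)[OF s] trace_def sum_distrib_right[symmetric] by simp
  finally show ?thesis .
qed

text \<open>The linear part has mean zero and the quadratic part contributes only through its trace,
  so the pointwise error passes to the average with no further loss.\<close>

lemma ball_avg_approx:
  fixes A :: "real^'n::finite^'n"
  assumes s: "0 < s" and f: "set_integrable lebesgue (ball x s) f"
    and approx: "\<And>h. norm h < s \<Longrightarrow> \<bar>f (x + h) - (a + g \<bullet> h + 1/2 * (h \<bullet> (A *v h)))\<bar> \<le> e"
  shows "\<bar>ball_avg s f x - (a + s\<^sup>2 / (2 * (CARD('n) + 2)) * trace A)\<bar> \<le> e"
proof -
  let ?B = "ball x s"
  define V where "V = measure lborel (ball (0::real^'n) s)"
  define Q where "Q y = a + g \<bullet> (y - x) + 1/2 * ((y - x) \<bullet> (A *v (y - x)))" for y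
  have V0: "measure lebesgue ?B = V"
    using s by (simp add: V_def content_ball)
  have Vpos: "0 < V" unfolding V_def using s by (simp add: content_ball_pos)
  have "continuous_on UNIV (\<lambda>y. (y - x) \<bullet> (A *v (y - x)))"
    by (rule continuous_on_compose2[OF continuous_on_matrix_form[of UNIV A]])
      (simp_all add: continuous_on_diff)
  then have Qc: "continuous_on UNIV Q"
    unfolding Q_def
    by (intro continuous_on_add[OF _ continuous_on_mult_left]) (intro continuous_intros)
  have Qb [measurable]: "Q \<in> borel_measurable borel" using Qc by (rule borel_measurable_continuous_onI)
  have Qi: "set_integrable lborel ?B Q" by (rule set_integrable_continuous_ball[OF Qc])
  have Qm: "(\<lambda>y. indicator ?B y *\<^sub>R Q y) \<in> borel_measurable lborel"
    using Qb by (intro borel_measurable_scaleR borel_measurable_indicator) auto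
  \<comment> \<open>The moments are known for \<open>lborel\<close>, whereas \<open>ball_avg\<close>
    integrates with respect to \<open>lebesgue\<close> because \<open>f\<close> need not be Borel.
    The polynomial \<open>Q\<close> is Borel, so its two integrals coincide.\<close>
  have Ql: "set_integrable lebesgue ?B Q"
    using Qi Qm unfolding set_integrable_def by (subst integrable_completion)
  have "(LINT y:?B|lebesgue. Q y) = (LINT y:?B|lborel. Q y)"
    unfolding set_lebesgue_integral_def by (rule integral_completion[OF Qm])
  also have "\<dots> = (LINT h:ball 0 s|lborel. Q (x + h))"
  proof -
    have "{h. x + 1 *\<^sub>R h \<in> ?B} = ball 0 s" by (auto simp: dist_norm)
    then show ?thesis
      using set_lebesgue_integral_affine[OF zero_less_one Qb _ Qi, where t=x] by simp
  qed
  also have "\<dots> = (LINT h:ball 0 s|lborel. a * 1 + (\<Sum>i\<in>UNIV. g $ i * h $ i) + 1/2 * (h \<bullet> (A *v h)))"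
    by (simp add: Q_def inner_vec_def)
  also have "\<dots> = a * V + 0 + 1/2 * (s\<^sup>2 / (CARD('n) + 2) * trace A * V)"
  proof -
    let ?B0 = "ball (0::real^'n) s"
    have i: "set_integrable lborel ?B0 (\<lambda>h. a * 1)"
      "set_integrable lborel ?B0 (\<lambda>h. \<Sum>i\<in>UNIV. g $ i * h $ i)"
      "set_integrable lborel ?B0 (\<lambda>h. 1/2 * (h \<bullet> (A *v h)))"
      by (intro set_integrable_continuous_ball continuous_intros continuous_on_matrix_form)+
    have "(LINT h:?B0|lborel. \<Sum>i\<in>UNIV. g $ i * h $ i) = (\<Sum>i\<in>UNIV. LINT h:?B0|lborel. g $ i * h $ i)"
      by (rule set_lebesgue_integral_sum) (intro set_integrable_continuous_ball continuous_intros)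
    then have 1: "(LINT h:?B0|lborel. \<Sum>i\<in>UNIV. g $ i * h $ i) = 0"
      by (simp only: set_integral_mult_right ball_moments(1)[OF s]) simp
    have 2: "(LINT h:?B0|lborel. a * 1) = a * V"
      unfolding set_integral_mult_right by (simp add: set_lebesgue_integral_def V_def)
    have 3: "(LINT h:?B0|lborel. 1/2 * (h \<bullet> (A *v h))) = 1/2 * (s\<^sup>2 / (CARD('n) + 2) * trace A * V)"
      by (simp only: set_integral_mult_right integral_ball_matrix_form[OF s] V_def)
    show ?thesis
      unfolding set_integral_add(2)[OF set_integral_add(1)[OF i(1,2)] i(3)]
        set_integral_add(2)[OF i(1,2)] 1 2 3 ..
  qed
  finally have IQ: "(LINT y:?B|lebesgue. Q y) = V * (a + s\<^sup>2 / (2 * (CARD('n) + 2)) * trace A)"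
    by (simp add: algebra_simps)
  have near: "\<bar>f y - Q y\<bar> \<le> e" if "y \<in> ?B" for y
  proof -
    have "norm (y - x) < s" using that by (simp add: dist_norm norm_minus_commute)
    from approx[OF this] show ?thesis by (simp add: Q_def)
  qed
  have ei: "set_integrable lebesgue ?B (\<lambda>y. e)"
    unfolding set_integrable_def by (intro integrable_scaleR_left integrable_real_indicator) (auto simp: emeasure_lborel_ball_finite[unfolded infinity_ennreal_def])
  have "(LINT y:?B|lebesgue. e) = e * V"
    using V0 by (simp add: set_lebesgue_integral_def)
  moreover have "(LINT y:?B|lebesgue. f y) \<le> (LINT y:?B|lebesgue. Q y + e)"
    by (intro set_integral_mono f set_integral_add Ql ei) (drule near, linarith)
  moreover have "(LINT y:?B|lebesgue. Q y) \<le> (LINT y:?B|lebesgue. f y + e)"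
    by (intro set_integral_mono f set_integral_add Ql ei) (drule near, linarith)
  ultimately have "\<bar>(LINT y:?B|lebesgue. f y) - (LINT y:?B|lebesgue. Q y)\<bar> \<le> e * V"
    by (simp add: set_integral_add f Ql ei abs_le_iff)
  then have "\<bar>(LINT y:?B|lebesgue. f y) / V - (LINT y:?B|lebesgue. Q y) / V\<bar> \<le> e"
    using Vpos by (simp add: diff_divide_distrib[symmetric] pos_divide_le_eq)
  then show ?thesis
    using Vpos by (simp add: IQ ball_avg_def V0)
qed

section \<open>Extrema over a ball\<close>

lemma norm_matrix_vector_mult_le:
  fixes A :: "real^'n::finite^'m::finite"
  shows "norm (A *v x) \<le> norm A * norm x"
proof -
  have "norm (A *v x) = L2_set (\<lambda>i. norm ((A *v x) $ i)) UNIV"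
    by (simp add: norm_vec_def)
  also have "\<dots> \<le> L2_set (\<lambda>i. norm (A $ i) * norm x) UNIV"
    by (intro L2_set_mono)
      (auto simp: matrix_mult_dot Cauchy_Schwarz_ineq2)
  also have "\<dots> = norm A * norm x"
    by (simp add: norm_vec_def[of A] L2_set_left_distrib)
  finally show ?thesis .
qed

lemma abs_matrix_form_le:
  fixes A :: "real^'n::finite^'n"
  shows "\<bar>x \<bullet> (A *v y)\<bar> \<le> norm A * norm x * norm y"
proof -
  have "\<bar>x \<bullet> (A *v y)\<bar> \<le> norm x * norm (A *v y)" by (rule Cauchy_Schwarz_ineq2)
  also have "\<dots> \<le> norm x * (norm A * norm y)"
    by (intro mult_left_mono norm_matrix_vector_mult_le) auto
  finally show ?thesis by (simp add: mult_ac)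
qed

lemma abs_trace_le:
  fixes A :: "real^'n::finite^'n"
  shows "\<bar>trace A\<bar> \<le> CARD('n) * norm A"
proof -
  have "\<bar>A $ i $ i\<bar> \<le> norm A" for i
    using component_le_norm_cart[of "A $ i" i] Finite_Cartesian_Product.norm_nth_le[of A i] by linarith
  then have "(\<Sum>i\<in>UNIV. \<bar>A $ i $ i\<bar>) \<le> (\<Sum>i\<in>(UNIV::'n set). norm A)" by (intro sum_mono)
  then show ?thesis
    unfolding trace_def by (intro order_trans[OF sum_abs]) simp
qed

text \<open>The case \<open>A = 0\<close>, \<open>g = 0\<close> is deliberately included: then \<open>sgn g = 0\<close> and \<open>0 / 0 = 0\<close> make the
  right-hand side \<open>0\<close>. Otherwise, moving \<open>h / s\<close> away from \<open>sgn g\<close> by \<open>t\<close> loses \<open>s \<bar>g\<bar> t\<^sup>2 / 2\<close> in the linear part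
  and gains at most \<open>s\<^sup>2 \<bar>A\<bar> t\<close> in the quadratic one.\<close>

lemma linear_plus_quadratic_le:
  fixes g h :: "real^'n::finite" and A :: "real^'n^'n"
  assumes s: "0 < s" "norm h \<le> s" and g: "g \<noteq> 0 \<or> A = 0"
  shows "g \<bullet> h + 1/2 * (h \<bullet> (A *v h)) \<le>
    s * norm g + s\<^sup>2 / 2 * (sgn g \<bullet> (A *v sgn g)) + s ^ 3 * (norm A)\<^sup>2 / (2 * norm g)"
proof (cases "A = 0")
  case True
  have "g \<bullet> h \<le> norm g * norm h" by (rule norm_cauchy_schwarz)
  also have "\<dots> \<le> norm g * s" using s by (intro mult_left_mono) auto
  finally show ?thesis using True by (simp add: mult.commute)
next
  case False
  with g have g0: "g \<noteq> 0" by simp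
  define G where "G = norm g"
  define u where "u = sgn g"
  define v where "v = h /\<^sub>R s"
  define t where "t = norm (v - u)"
  have G: "0 < G" and gu: "g = G *\<^sub>R u" and nu: "norm u = 1"
    using g0 by (auto simp: G_def u_def sgn_div_norm)
  have h: "h = s *\<^sub>R v" and nv: "norm v \<le> 1" using s by (auto simp: v_def field_simps)
  have "t\<^sup>2 = (norm v)\<^sup>2 + 1 - 2 * (u \<bullet> v)"
    by (simp add: t_def power2_norm_eq_inner nu[unfolded norm_eq_1] inner_diff algebra_simps inner_commute)
  moreover have "(norm v)\<^sup>2 \<le> 1" using nv by (simp add: power_le_one)
  ultimately have uv: "u \<bullet> v \<le> 1 - t\<^sup>2 / 2" by linarith
  have "v \<bullet> (A *v v) - u \<bullet> (A *v u) = (v - u) \<bullet> (A *v v) + u \<bullet> (A *v (v - u))"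
    by (simp add: inner_diff matrix_vector_mult_diff_distrib)
  also have "\<dots> \<le> norm A * t * norm v + norm A * norm u * t"
    using abs_matrix_form_le[of "v - u" A v] abs_matrix_form_le[of u A "v - u"] by (auto simp: t_def)
  also have "norm A * t * norm v \<le> norm A * t * 1"
    using nv by (intro mult_left_mono) (auto simp: t_def)
  finally have q: "v \<bullet> (A *v v) - u \<bullet> (A *v u) \<le> 2 * norm A * t" by (simp add: nu mult_ac)
  \<comment> \<open>Expanding this square pays for the gain in the quadratic part with the entire
    loss in the linear part. What is left over no longer depends on \<open>t\<close>.\<close>
  have "0 \<le> s * (G * t - s * norm A)\<^sup>2 / (2 * G)" using s G by simp
  also have "\<dots> = s * G * (t\<^sup>2 / 2) + s ^ 3 * (norm A)\<^sup>2 / (2 * G) - s\<^sup>2 * norm A * t"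
    using G by (simp add: field_simps power2_eq_square power3_eq_cube)
  finally have amgm: "s\<^sup>2 * norm A * t \<le> s * G * (t\<^sup>2 / 2) + s ^ 3 * (norm A)\<^sup>2 / (2 * G)"
    by simp
  have "g \<bullet> h + 1/2 * (h \<bullet> (A *v h)) = s * G * (u \<bullet> v) + s\<^sup>2 / 2 * (v \<bullet> (A *v v))"
    by (simp add: gu h matrix_vector_mult_scaleR power2_eq_square)
  also have "\<dots> \<le> s * G * (1 - t\<^sup>2 / 2) + s\<^sup>2 / 2 * (u \<bullet> (A *v u) + 2 * norm A * t)"
    using uv q G s by (intro add_mono mult_left_mono) auto
  also have "\<dots> = s * G + s\<^sup>2 / 2 * (u \<bullet> (A *v u)) + (s\<^sup>2 * norm A * t - s * G * (t\<^sup>2 / 2))"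
    by (simp add: algebra_simps)
  finally show ?thesis using amgm by (simp add: G_def u_def)
qed

text \<open>The cubic remainder is present only on the upper side, since the lower bound comes from
  testing along \<open>sgn g\<close> itself. The ball is open, so the test point
  \<open>s * sgn g\<close> is only approached, through the factors \<open>u < 1\<close>.\<close>

lemma SUP_ball_approx:
  fixes A :: "real^'n::finite^'n"
  assumes s: "0 < s" and g: "g \<noteq> 0 \<or> A = 0"
    and approx: "\<And>h. norm h < s \<Longrightarrow> \<bar>f (x + h) - (a + g \<bullet> h + 1/2 * (h \<bullet> (A *v h)))\<bar> \<le> e"
  defines "c \<equiv> a + s * norm g + s\<^sup>2 / 2 * (sgn g \<bullet> (A *v sgn g))"
  shows "c - e \<le> (SUP y\<in>ball x s. f y)"
    and "(SUP y\<in>ball x s. f y) \<le> c + s ^ 3 * (norm A)\<^sup>2 / (2 * norm g) + e"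
proof -
  have up: "f y \<le> c + s ^ 3 * (norm A)\<^sup>2 / (2 * norm g) + e" if "y \<in> ball x s" for y
  proof -
    have h: "norm (y - x) < s" using that by (simp add: dist_norm norm_minus_commute)
    from approx[OF this] linear_plus_quadratic_le[OF s less_imp_le[OF h] g]
    show ?thesis by (simp add: c_def)
  qed
  then show "(SUP y\<in>ball x s. f y) \<le> c + s ^ 3 * (norm A)\<^sup>2 / (2 * norm g) + e"
    using s by (intro cSUP_least) auto
  have bdd: "bdd_above (f ` ball x s)" using up by (auto intro!: bdd_aboveI)
  define l where "l u = a + u * s * norm g + u\<^sup>2 * s\<^sup>2 / 2 * (sgn g \<bullet> (A *v sgn g)) - e" for u
  have low: "l u \<le> (SUP y\<in>ball x s. f y)" if u: "0 < u" "u < 1" for u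
  proof -
    define h where "h = (u * s) *\<^sub>R sgn g"
    have "norm h \<le> u * s" using u s by (simp add: h_def norm_sgn)
    also have "u * s < s" using u s by simp
    finally have h: "norm h < s" .
    have "g \<bullet> sgn g = norm g"
      by (cases "g = 0") (auto simp: sgn_div_norm dot_square_norm power2_eq_square)
    then have "l u = a + g \<bullet> h + 1/2 * (h \<bullet> (A *v h)) - e"
      by (simp add: l_def h_def matrix_vector_mult_scaleR power2_eq_square mult_ac)
    also have "\<dots> \<le> f (x + h)" using approx[OF h] by linarith
    also have "\<dots> \<le> (SUP y\<in>ball x s. f y)"
      using h by (intro cSUP_upper bdd) (auto simp: dist_norm)
    finally show ?thesis .
  qed
  have "(l \<longlongrightarrow> l 1) (at_left 1)"
    unfolding l_def by (intro tendsto_intros) simp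
  moreover have "\<forall>\<^sub>F u in at_left 1. l u \<le> (SUP y\<in>ball x s. f y)"
    using eventually_at_left_real[of 0 "1::real"] by (auto elim!: eventually_mono intro: low)
  ultimately have "l 1 \<le> (SUP y\<in>ball x s. f y)"
    by (rule tendsto_upperbound) simp
  then show "c - e \<le> (SUP y\<in>ball x s. f y)" by (simp add: l_def c_def)
qed

text \<open>The real infimum is defined by this reflection, default values included. Sign changes in
  \<open>f\<close> can therefore be carried through all the operators as plain identities.\<close>

lemma INF_eq_neg_SUP:
  fixes f :: "'a \<Rightarrow> real"
  shows "(INF y\<in>S. f y) = - (SUP y\<in>S. - f y)"
  by (simp add: Inf_real_def image_image)

lemma INF_ball_approx:
  fixes A :: "real^'n::finite^'n"
  assumes s: "0 < s" and g: "g \<noteq> 0 \<or> A = 0"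
    and approx: "\<And>h. norm h < s \<Longrightarrow> \<bar>f (x + h) - (a + g \<bullet> h + 1/2 * (h \<bullet> (A *v h)))\<bar> \<le> e"
  defines "c \<equiv> a - s * norm g + s\<^sup>2 / 2 * (sgn g \<bullet> (A *v sgn g))"
  shows "(INF y\<in>ball x s. f y) \<le> c + e"
    and "c - s ^ 3 * (norm A)\<^sup>2 / (2 * norm g) - e \<le> (INF y\<in>ball x s. f y)"
proof -
  have neg: "- g \<noteq> 0 \<or> - A = 0" using g by auto
  have m: "(- A) *v y = - (A *v y)" for y
    using matrix_vector_mult_diff_rdistrib[of 0 A y] by simp
  have m2: "A *v (- y) = - (A *v y)" for y
    using matrix_vector_mult_diff_distrib[of A 0 y] by simp
  have a: "\<bar>- f (x + h) - (- a + (- g) \<bullet> h + 1/2 * (h \<bullet> ((- A) *v h)))\<bar> \<le> e" if "norm h < s" for h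
    using approx[OF that] by (simp add: m)
  note S = SUP_ball_approx[of s "- g" "- A" "\<lambda>y. - f y" x "- a" e, OF s neg a]
  show "(INF y\<in>ball x s. f y) \<le> c + e"
    and "c - s ^ 3 * (norm A)\<^sup>2 / (2 * norm g) - e \<le> (INF y\<in>ball x s. f y)"
    using S by (simp_all add: INF_eq_neg_SUP c_def m m2 sgn_minus)
qed

section \<open>Optimizing over \<open>c\<close>\<close>

text \<open>The main part of \<open>(up_term p \<epsilon> f x c - f x) / \<epsilon>\<^sup>2\<close>,
  with \<open>G\<close> the length of the gradient.\<close>

definition envelope :: "real \<Rightarrow> real \<Rightarrow> real \<Rightarrow> real \<Rightarrow> real" where
  "envelope al G N c = al * (c powr (1 - al) * G) + (1 - al) * (c powr (- al) * N)"

text \<open>The positive part of the infimum of \<open>envelope al G N\<close> over all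
  \<open>c > 0\<close>. Because \<open>0 powr q = 0\<close>, the formula also gives the correct
  value 0 when \<open>N \<le> 0\<close> or \<open>G = 0\<close>.\<close>

definition envelope_min :: "real \<Rightarrow> real \<Rightarrow> real \<Rightarrow> real" where
  "envelope_min al G N = max 0 N powr (1 - al) * G powr al"

lemma envelope_min_nonneg: "0 \<le> envelope_min al G N"
  by (simp add: envelope_min_def)

text \<open>Young's inequality with weights \<open>al\<close> and \<open>1 - al\<close>, in which
  the powers of \<open>c\<close> cancel. In the degenerate cases the left-hand side is 0, which
  explains the maximum on the right.\<close>

lemma envelope_min_le_envelope:
  assumes al: "0 < al" "al < 1" and c: "0 < c" and G: "0 \<le> G"
  shows "envelope_min al G N \<le> max 0 (envelope al G N c)"
proof (cases "0 < N \<and> 0 < G")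
  case True
  have "envelope_min al G N = (c powr (1 - al) * G) powr al * (c powr (- al) * N) powr (1 - al)"
  proof -
    have "c powr ((1 - al) * al) * c powr (- al * (1 - al)) = 1"
      using c by (simp add: powr_add[symmetric] algebra_simps)
    then show ?thesis using True c
      by (simp add: envelope_min_def powr_mult powr_powr algebra_simps) 
  qed
  also have "\<dots> \<le> envelope al G N c"
    unfolding envelope_def using True c al by (intro Youngs_inequality_0) auto
  finally show ?thesis by simp
next
  case False
  then have "envelope_min al G N = 0"
    using G al by (auto simp: envelope_min_def max_def)
  then show ?thesis by simp
qed

text \<open>The unconstrained minimizer \<open>N / G\<close> is used if it is admissible, otherwise
  the nearer endpoint. At an endpoint the two terms of \<open>envelope\<close> compare in a known
  direction, so their weighted mean is at most the larger of the two; for \<open>N \<le> 0\<close>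
  the endpoint \<open>m\<close> makes the second term nonpositive.\<close>

lemma ex_envelope_le:
  assumes al: "0 < al" "al < 1" and m: "0 < m" "m \<le> M" and G: "0 \<le> G"
  shows "\<exists>c\<in>{m..M}. envelope al G N c \<le>
    envelope_min al G N + m powr (1 - al) * G + M powr (- al) * max 0 N"
proof -
  have M: "0 < M" using m by simp
  \<comment> \<open>The second case, where \<open>N / G\<close> lies beyond \<open>M\<close>,
    includes \<open>G = 0\<close>. The products avoid dividing by \<open>G\<close>.\<close>
  consider "N \<le> 0" | "0 < N" "M * G < N" | "0 < N" "N < m * G" | "0 < N" "m * G \<le> N" "N \<le> M * G"
    by linarith
  then show ?thesis
  proof cases
    case 1
    have "al * (m powr (1 - al) * G) \<le> 1 * (m powr (1 - al) * G)"
      using al G by (intro mult_right_mono) auto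
    moreover have "(1 - al) * (m powr (- al) * N) \<le> 0"
      using al 1 by (intro mult_nonneg_nonpos) auto
    ultimately have "envelope al G N m \<le> m powr (1 - al) * G"
      unfolding envelope_def by simp
    moreover have "0 \<le> M powr (- al) * max 0 N" by simp
    ultimately show ?thesis using m envelope_min_nonneg[of al G N]
      by (intro bexI[of _ m]) (linarith, simp)
  next
    case 2
    have "M powr (1 - al) * G = M powr (- al) * (M * G)"
      using M by (simp add: powr_diff powr_minus field_simps)
    also have "\<dots> \<le> M powr (- al) * N" using 2 by (intro mult_left_mono) auto
    finally have "al * (M powr (1 - al) * G) \<le> al * (M powr (- al) * N)"
      using al by (intro mult_left_mono) auto
    then have "envelope al G N M \<le> M powr (- al) * N"
      unfolding envelope_def by (simp add: algebra_simps)
    moreover have "0 \<le> m powr (1 - al) * G" using G by simp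
    ultimately show ?thesis using m 2 envelope_min_nonneg[of al G N] by (intro bexI[of _ M]) auto
  next
    case 3
    have "m powr (- al) * N \<le> m powr (- al) * (m * G)" using 3 by (intro mult_left_mono) auto
    also have "\<dots> = m powr (1 - al) * G"
      using m by (simp add: powr_diff powr_minus field_simps)
    finally have "(1 - al) * (m powr (- al) * N) \<le> (1 - al) * (m powr (1 - al) * G)"
      using al by (intro mult_left_mono) auto
    then have "envelope al G N m \<le> m powr (1 - al) * G"
      unfolding envelope_def by (simp add: algebra_simps)
    moreover have "0 \<le> M powr (- al) * max 0 N" by simp
    ultimately show ?thesis using m envelope_min_nonneg[of al G N]
      by (intro bexI[of _ m]) (linarith, simp)
  next
    case 4
    then have G0: "0 < G" using G m by (metis less_eq_real_def mult_zero_right not_less)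
    define c where "c = N / G"
    have c: "c \<in> {m..M}" "0 < c" using 4 G0 by (auto simp: c_def field_simps)
    have "c powr (1 - al) * G = N powr (1 - al) * G powr al"
      using 4 G0 by (simp add: c_def powr_divide powr_diff field_simps)
    moreover have "c powr (- al) * N = N powr (1 - al) * G powr al"
      using 4 G0 by (simp add: c_def powr_divide powr_diff powr_minus field_simps)
    ultimately have "envelope al G N c = envelope_min al G N"
      using 4 by (simp add: envelope_def envelope_min_def algebra_simps)
    moreover have "0 \<le> m powr (1 - al) * G" "0 \<le> M powr (- al) * max 0 N" using G by auto
    ultimately show ?thesis using c by (intro bexI[of _ c]) auto
  qed
qed

section \<open>Taylor expansion and uniform norms\<close>

lemma Ck_on_imp_continuous_on: "Ck_on k S f \<Longrightarrow> continuous_on S f"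
proof (cases k)
  case (Suc n)
  assume "Ck_on k S f"
  then show ?thesis using Suc
    by (auto intro!: continuous_at_imp_continuous_on differentiable_imp_continuous_within)
qed simp

lemma Ck_on_Suc_imp: "Ck_on (Suc k) S f \<Longrightarrow> Ck_on k S f"
proof (induction k arbitrary: f)
  case 0
  then show ?case using Ck_on_imp_continuous_on[of "Suc 0" S f] by simp
next
  case (Suc k)
  then show ?case by auto
qed

lemma continuous_on_grad: "Ck_on 2 S f \<Longrightarrow> continuous_on S (grad f)"
  unfolding grad_def
  by (intro continuous_on_vec_lambda) (auto simp: numeral_2_eq_2 intro: Ck_on_imp_continuous_on[of 1])

lemma continuous_on_D2: "Ck_on 2 S f \<Longrightarrow> continuous_on S (D2 f)"
  unfolding D2_def
  by (intro continuous_on_vec_lambda) (simp add: numeral_2_eq_2)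

lemma continuous_on_D3: "Ck_on 3 S f \<Longrightarrow> continuous_on S (D3 f)"
  unfolding D3_def
  by (intro continuous_on_vec_lambda) (simp add: numeral_3_eq_3)

lemma has_derivative_grad:
  assumes "f differentiable (at y)"
  shows "(f has_derivative (\<lambda>h. grad f y \<bullet> h)) (at y)"
proof -
  have "(\<lambda>h. grad f y \<bullet> h) = frechet_derivative f (at y)"
    by (auto simp: fun_eq_iff frechet_partial[OF assms] grad_def inner_vec_def mult.commute)
  then show ?thesis using assms frechet_derivative_works by metis
qed

lemma has_derivative_D2:
  assumes "Ck_on 3 S f" "y \<in> S"
  shows "(D2 f has_derivative (\<lambda>h. \<chi> i j. D3 f y $ i $ j \<bullet> h)) (at y)"
proof -
  have "(partial j (partial i f) has_derivative (\<lambda>h. D3 f y $ i $ j \<bullet> h)) (at y)" for i j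
  proof -
    have "partial j (partial i f) differentiable (at y)"
      using assms by (simp add: numeral_3_eq_3)
    from has_derivative_grad[OF this] show ?thesis by (simp add: D3_def grad_def)
  qed
  then have "((\<lambda>y. D2 f y $ i $ j) has_derivative (\<lambda>h. D3 f y $ i $ j \<bullet> h)) (at y)" for i j
    by (simp add: D2_def)
  note d = this
  have "((\<lambda>y. D2 f y $ i) has_derivative (\<lambda>h. \<chi> j. D3 f y $ i $ j \<bullet> h)) (at y)" for i
    using d unfolding has_derivative_componentwise_within[where S=UNIV, of "\<lambda>y. D2 f y $ i"]
    by (auto simp: Basis_vec_def inner_axis)
  then show ?thesis
    unfolding has_derivative_componentwise_within[where S=UNIV, of "D2 f"]
    using d by (auto simp: Basis_vec_def inner_axis)
qed

text \<open>The mean value inequality on a convex ball: the Frobenius norm of the third derivative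
  dominates the operator norm of its contraction with a vector.\<close>

lemma norm_D2_diff_le:
  fixes f :: "real^'n::finite \<Rightarrow> real"
  assumes f: "Ck_on 3 S f" and sub: "ball x s \<subseteq> S" and y: "y \<in> ball x s"
    and K: "\<And>y. y \<in> ball x s \<Longrightarrow> norm (D3 f y) \<le> K"
  shows "norm (D2 f y - D2 f x) \<le> K * norm (y - x)"
proof (rule differentiable_bound[where S = "ball x s" and f' = "\<lambda>y h. \<chi> i j. D3 f y $ i $ j \<bullet> h"])
  show "(D2 f has_derivative (\<lambda>h. \<chi> i j. D3 f z $ i $ j \<bullet> h)) (at z within ball x s)"
    if "z \<in> ball x s" for z
    using has_derivative_at_withinI[OF has_derivative_D2[OF f]] that sub by blast
  show "onorm (\<lambda>h. \<chi> i j. D3 f z $ i $ j \<bullet> h) \<le> K" if z: "z \<in> ball x s" for z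
  proof (rule onorm_le)
    fix h :: "real^'n"
    have "norm (\<chi> i j. D3 f z $ i $ j \<bullet> h) = L2_set (\<lambda>i. norm (D3 f z $ i *v h)) UNIV"
      unfolding norm_vec_def[of "\<chi> i j. D3 f z $ i $ j \<bullet> h"] by (simp add: matrix_mult_dot)
    also have "\<dots> \<le> L2_set (\<lambda>i. norm (D3 f z $ i) * norm h) UNIV"
      by (intro L2_set_mono norm_matrix_vector_mult_le) auto
    also have "\<dots> = norm (D3 f z) * norm h"
      by (simp add: norm_vec_def[of "D3 f z"] L2_set_left_distrib)
    also have "\<dots> \<le> K * norm h" using K[OF z] by (intro mult_right_mono) auto
    finally show "norm (\<chi> i j. D3 f z $ i $ j \<bullet> h) \<le> K * norm h" .
  qed
qed (use y in \<open>auto intro: centre_in_ball[THEN iffD2] simp: zero_less_dist_iff intro: le_less_trans[OF zero_le_dist]\<close>)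

text \<open>The comparison matrix \<open>A\<close> is left free so that one statement covers all
  expansions: \<open>A = D2 f x\<close> gives the second and third order ones, and
  \<open>A = 0\<close> the first order one with a bound on the Hessian as \<open>w\<close>.\<close>

lemma taylor_second_order:
  fixes f :: "real^'n::finite \<Rightarrow> real"
  assumes f: "Ck_on 2 S f" and sub: "ball x s \<subseteq> S" and h: "norm h < s"
    and w: "\<And>y. y \<in> ball x s \<Longrightarrow> norm (D2 f y - A) \<le> w"
  shows "\<bar>f (x + h) - (f x + grad f x \<bullet> h + 1/2 * (h \<bullet> (A *v h)))\<bar> \<le> 1/2 * w * s\<^sup>2"
proof -
  define \<gamma> where "\<gamma> t = x + t *\<^sub>R h" for t :: real
  \<comment> \<open>The derivatives of orders 0, 1 and 2 of \<open>f\<close> along the segment from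
    \<open>x\<close> to \<open>x + h\<close>, in the format of the Maclaurin formula.\<close>
  define diff where "diff = (\<lambda>m::nat. if m = 0 then (\<lambda>t. f (\<gamma> t)) else if m = 1 then
     (\<lambda>t. grad f (\<gamma> t) \<bullet> h) else (\<lambda>t. h \<bullet> (D2 f (\<gamma> t) *v h)))"
  have g: "\<gamma> t \<in> ball x s" if "0 \<le> t" "t \<le> 1" for t
  proof -
    have "t * norm h \<le> 1 * norm h" using that by (intro mult_right_mono) auto
    then show ?thesis using h that by (simp add: \<gamma>_def dist_norm)
  qed
  have dg: "(\<gamma> has_derivative (\<lambda>d. d *\<^sub>R h)) (at t)" for t
    unfolding \<gamma>_def by (auto intro!: derivative_eq_intros)
  have d0: "DERIV (diff 0) t :> diff 1 t" if "\<gamma> t \<in> S" for t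
  proof -
    have "f differentiable (at (\<gamma> t))" using Ck2D(1)[OF f that] .
    from has_derivative_compose[OF dg has_derivative_grad[OF this]]
    show ?thesis by (simp add: diff_def has_field_derivative_def mult_commute_abs)
  qed
  have d1: "DERIV (diff 1) t :> diff 2 t" if "\<gamma> t \<in> S" for t
  proof -
    from has_derivative_inner_left[OF has_derivative_compose[OF dg grad_has_derivative[OF f that]], of h]
    show ?thesis
      by (simp add: diff_def has_field_derivative_def matrix_vector_mult_scaleR inner_commute mult_commute_abs)
  qed
  have "\<exists>t>0. t < 1 \<and> f (\<gamma> 1) = (\<Sum>m<2. diff m 0 / fact m * 1 ^ m) + diff 2 t / fact 2 * 1 ^ 2"
  proof (rule Maclaurin)
    show "\<forall>m t. m < 2 \<and> 0 \<le> t \<and> t \<le> 1 \<longrightarrow> DERIV (diff m) t :> diff (Suc m) t"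
    proof (intro allI impI)
      fix m :: nat and t :: real
      assume *: "m < 2 \<and> 0 \<le> t \<and> t \<le> 1"
      then have "\<gamma> t \<in> S" using g sub by blast
      moreover have "m = 0 \<or> m = 1" using * by auto
      ultimately show "DERIV (diff m) t :> diff (Suc m) t"
        using d0[of t] d1[of t] by (auto simp: numeral_2_eq_2)
    qed
  qed (auto simp: diff_def)
  then obtain t where t: "0 < t" "t < 1"
    and eq: "f (\<gamma> 1) = (\<Sum>m<2. diff m 0 / fact m * 1 ^ m) + diff 2 t / fact 2 * 1 ^ 2" by blast
  have "f (x + h) = f x + grad f x \<bullet> h + 1/2 * (h \<bullet> (D2 f (\<gamma> t) *v h))"
    using eq by (simp add: numeral_2_eq_2 diff_def \<gamma>_def)
  then have "\<bar>f (x + h) - (f x + grad f x \<bullet> h + 1/2 * (h \<bullet> (A *v h)))\<bar>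
    = 1/2 * \<bar>h \<bullet> ((D2 f (\<gamma> t) - A) *v h)\<bar>"
    by (simp add: matrix_vector_mult_diff_rdistrib inner_diff_right diff_divide_distrib[symmetric])
  also have "\<dots> \<le> 1/2 * (norm (D2 f (\<gamma> t) - A) * norm h * norm h)"
    by (intro mult_left_mono abs_matrix_form_le) auto
  also have "\<dots> \<le> 1/2 * (w * s * s)"
  proof (intro mult_left_mono mult_mono)
    show wA: "norm (D2 f (\<gamma> t) - A) \<le> w" using w g t by simp
    show "0 \<le> w" using wA norm_ge_zero[of "D2 f (\<gamma> t) - A"] by linarith
    then show "0 \<le> w * s" using h norm_ge_zero[of h] by (intro mult_nonneg_nonneg) linarith+
  qed (use h in auto)
  finally show ?thesis by (simp add: power2_eq_square mult_ac)
qed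

text \<open>A point violating the essential bound would, by continuity, have a neighbourhood of
  violating points, and a nonempty open set is not negligible. The gap \<open>r < R\<close> makes
  the closed ball a compact subset of the domain, so the essential supremum is finite and
  \<open>real_of_ereal\<close> does not send it to 0.\<close>

lemma norm_le_Linf_norm:
  fixes F :: "real^'n::finite \<Rightarrow> 'b::real_normed_vector"
  assumes F: "continuous_on (ball x R) F" and r: "r < R" and y: "y \<in> ball x r"
  shows "norm (F y) \<le> Linf_norm (ball x r) F"
proof -
  let ?M = "lebesgue_on (ball x r)"
  define L where "L = esssup ?M (\<lambda>y. ereal (norm (F y)))"
  have sub: "cball x r \<subseteq> ball x R" using r by auto
  have Fc: "continuous_on (ball x r) (\<lambda>y. norm (F y))"
    using r by (intro continuous_on_norm continuous_on_subset[OF F]) auto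
  have meas: "(\<lambda>y. ereal (norm (F y))) \<in> borel_measurable ?M"
    by (intro borel_measurable_ereal continuous_imp_measurable_on_sets_lebesgue[OF Fc]) auto
  have "compact ((\<lambda>y. norm (F y)) ` cball x r)"
    by (intro compact_continuous_image continuous_on_norm continuous_on_subset[OF F] sub) auto
  then obtain B where B: "\<And>y. y \<in> cball x r \<Longrightarrow> norm (F y) \<le> B"
    by (metis bounded_real compact_imp_bounded image_eqI abs_le_D1)
  have "L \<le> ereal B" unfolding L_def
    by (rule esssup_I[OF meas]) (use B in \<open>auto intro!: AE_I2\<close>)
  moreover have ae: "AE z in ?M. ereal (norm (F z)) \<le> L" unfolding L_def by (rule esssup_AE)
  have L: "ereal (norm (F z)) \<le> L" if z: "z \<in> ball x r" for z
  proof (rule ccontr)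
    assume "\<not> ?thesis"
    then have less: "L < ereal (norm (F z))" by simp
    define U where "U = {w \<in> ball x r. L < ereal (norm (F w))}"
    have "U = ball x r \<inter> (\<lambda>w. ereal (norm (F w))) -` {L<..}" by (auto simp: U_def)
    moreover have "continuous_on (ball x r) (\<lambda>w. ereal (norm (F w)))"
      using Fc by (intro continuous_on_ereal)
    ultimately have "open U" by (simp add: continuous_open_preimage)
    moreover have "z \<in> U" using z less by (simp add: U_def)
    ultimately have "\<not> negligible U" using open_not_negligible by blast
    moreover have "negligible U"
    proof -
      have "AE w in lebesgue. w \<in> ball x r \<longrightarrow> ereal (norm (F w)) \<le> L"
        using ae by (simp add: AE_restrict_space_iff)
      then have "AE w in lebesgue. w \<notin> U"
        by eventually_elim (auto simp: U_def)
      then show ?thesis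
        by (metis AE_iff_null_sets Collect_mem_eq \<open>open U\<close> lebesgue_openin negligible_iff_null_sets null_sets_def openin_subtopology_self sets_completionI_sets borel_open lborelD sets_lborel)
    qed
    ultimately show False by simp
  qed
  have "0 \<le> L" using order_trans[OF _ L[OF y]] by simp
  then have "L = ereal (real_of_ereal L)" using \<open>L \<le> ereal B\<close> by (cases L) auto
  then show ?thesis using L[OF y] unfolding Linf_norm_def L_def[symmetric]
    by (metis ereal_less_eq(3))
qed

section \<open>Expansion of the averaging operator\<close>

definition normalized_p_lap :: "real \<Rightarrow> real^'n::finite \<Rightarrow> real^'n^'n \<Rightarrow> real" where
  "normalized_p_lap p g A = trace A + (p - 2) * ((A *v sgn g) \<bullet> sgn g)"

lemma abs_normalized_p_lap_le:
  fixes A :: "real^'n::finite^'n"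
  assumes "2 < p"
  shows "\<bar>normalized_p_lap p g A\<bar> \<le> (p + CARD('n)) * norm A"
proof -
  have "\<bar>(A *v sgn g) \<bullet> sgn g\<bar> \<le> norm A * norm (sgn g) * norm (sgn g)"
    using abs_matrix_form_le[of "sgn g" A "sgn g"] by (simp add: inner_commute)
  also have "\<dots> \<le> norm A * 1 * 1"
    by (intro mult_mono) (auto simp: norm_sgn)
  finally have "(p - 2) * \<bar>(A *v sgn g) \<bullet> sgn g\<bar> \<le> (p - 2) * norm A"
    using assms by (intro mult_left_mono) auto
  moreover have "\<bar>normalized_p_lap p g A\<bar> \<le> \<bar>trace A\<bar> + (p - 2) * \<bar>(A *v sgn g) \<bullet> sgn g\<bar>"
    unfolding normalized_p_lap_def using assms
    by (intro order_trans[OF abs_triangle_ineq]) (simp add: abs_mult)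
  ultimately have "\<bar>normalized_p_lap p g A\<bar> \<le> CARD('n) * norm A + (p - 2) * norm A"
    using abs_trace_le[of A] by linarith
  also have "\<dots> \<le> (p + CARD('n)) * norm A" by (simp add: algebra_simps)
  finally show ?thesis .
qed

text \<open>This is where the values of \<open>beta\<close> and \<open>gamma\<close> come from. With
  s^2 = 2 (p + d) \<rho>^2, the identities \<beta> (p + d) = p - 2 and (1 - \<beta>)(p + d) = d + 2
  turn the Hessian in the gradient direction and the trace into exactly the two parts of
  \<open>normalized_p_lap\<close>.\<close>

lemma M_op_approx:
  fixes A :: "real^'n::finite^'n"
  assumes p: "2 < p" and \<rho>: "0 < \<rho>" and g: "g \<noteq> 0 \<or> A = 0"
  defines "s \<equiv> gamma p CARD('n) * \<rho>"
  assumes f: "set_integrable lebesgue (ball x s) f"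
    and approx: "\<And>h. norm h < s \<Longrightarrow> \<bar>f (x + h) - (a + g \<bullet> h + 1/2 * (h \<bullet> (A *v h)))\<bar> \<le> e"
  shows "\<bar>M_op p \<rho> f x - (a + \<rho>\<^sup>2 * normalized_p_lap p g A)\<bar>
    \<le> e + s ^ 3 * (norm A)\<^sup>2 / (2 * norm g)"
proof -
  define d where "d = real CARD('n)"
  define \<beta> where "\<beta> = beta p CARD('n)"
  define q where "q = sgn g \<bullet> (A *v sgn g)"
  define T where "T = s ^ 3 * (norm A)\<^sup>2 / (2 * norm g)"
  define S where "S = (SUP y\<in>ball x s. f y)"
  define I where "I = (INF y\<in>ball x s. f y)"
  have d: "1 \<le> d" by (simp add: d_def)
  have "0 < gamma p CARD('n)" using p d by (simp add: gamma_def d_def)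
  then have s: "0 < s" using \<rho> by (simp add: s_def)
  have s2: "s\<^sup>2 = 2 * (p + d) * \<rho>\<^sup>2"
    using p d by (simp add: s_def gamma_def power_mult_distrib d_def)
  have \<beta>: "0 \<le> \<beta>" "\<beta> \<le> 1" using p d by (auto simp: \<beta>_def beta_def d_def field_simps)
  have T: "0 \<le> T" using s by (simp add: T_def)
  note sup = SUP_ball_approx[OF s g approx, folded S_def q_def T_def]
  note inf = INF_ball_approx[OF s g approx, folded I_def q_def T_def]
  have avg: "\<bar>ball_avg s f x - (a + s\<^sup>2 / (2 * (d + 2)) * trace A)\<bar> \<le> e"
    using ball_avg_approx[OF s f approx] by (simp add: d_def add.commute)
  \<comment> \<open>The first order terms \<open>s * norm g\<close> of the supremum and of the
    infimum have opposite signs and cancel in the midrange.\<close>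
  have "\<bar>(S + I) / 2 - (a + s\<^sup>2 / 2 * q)\<bar> \<le> e + T"
    using sup inf T unfolding abs_le_iff by (auto simp: field_simps)
  then have "\<beta> * \<bar>(S + I) / 2 - (a + s\<^sup>2 / 2 * q)\<bar> \<le> \<beta> * (e + T)"
    using \<beta> by (intro mult_left_mono)
  moreover have "(1 - \<beta>) * \<bar>ball_avg s f x - (a + s\<^sup>2 / (2 * (d + 2)) * trace A)\<bar> \<le> (1 - \<beta>) * (e + T)"
    using \<beta> avg T by (intro mult_left_mono) auto
  ultimately have "\<bar>\<beta> * ((S + I) / 2 - (a + s\<^sup>2 / 2 * q)) +
    (1 - \<beta>) * (ball_avg s f x - (a + s\<^sup>2 / (2 * (d + 2)) * trace A))\<bar> \<le> \<beta> * (e + T) + (1 - \<beta>) * (e + T)"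
    using \<beta> by (intro order_trans[OF abs_triangle_ineq]) (simp add: abs_mult)
  moreover have "\<beta> * ((S + I) / 2 - (a + s\<^sup>2 / 2 * q)) +
    (1 - \<beta>) * (ball_avg s f x - (a + s\<^sup>2 / (2 * (d + 2)) * trace A)) =
    M_op p \<rho> f x - (a + \<rho>\<^sup>2 * normalized_p_lap p g A)"
  proof -
    have "M_op p \<rho> f x = \<beta> / 2 * (S + I) + (1 - \<beta>) * ball_avg s f x"
      by (simp add: M_op_def Let_def S_def I_def \<beta>_def s_def)
    moreover have "\<beta> * (s\<^sup>2 / 2 * q) = \<rho>\<^sup>2 * ((p - 2) * q)"
    proof -
      have "\<beta> * (p + d) = p - 2" using p d by (simp add: \<beta>_def beta_def d_def[symmetric])
      moreover have "\<beta> * (s\<^sup>2 / 2 * q) = \<rho>\<^sup>2 * (\<beta> * (p + d) * q)" unfolding s2 by simp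
      ultimately show ?thesis by simp
    qed
    moreover have "(1 - \<beta>) * (s\<^sup>2 / (2 * (d + 2)) * trace A) = \<rho>\<^sup>2 * trace A"
    proof -
      have "1 - \<beta> = (d + 2) / (p + d)" using p d by (simp add: \<beta>_def beta_def d_def[symmetric] field_simps)
      then have "(1 - \<beta>) * (p + d) = d + 2" using p d by simp
      moreover have "(1 - \<beta>) * (s\<^sup>2 / (2 * (d + 2)) * trace A) =
        \<rho>\<^sup>2 * trace A * ((1 - \<beta>) * (p + d) / (d + 2))"
        unfolding s2 using d by (simp add: divide_simps) (simp add: algebra_simps)
      ultimately show ?thesis using d by simp
    qed
    moreover have "normalized_p_lap p g A = trace A + (p - 2) * q"
      by (simp add: normalized_p_lap_def q_def inner_commute)
    moreover have "\<beta> * ((S + I) / 2 - (a + t)) + (1 - \<beta>) * (ball_avg s f x - (a + t')) =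
      (\<beta> / 2 * (S + I) + (1 - \<beta>) * ball_avg s f x) - (a + (\<beta> * t + (1 - \<beta>) * t'))" for t t'
      by (simp add: algebra_simps)
    ultimately show ?thesis by (simp add: distrib_left)
  qed
  moreover have "\<beta> * (e + T) + (1 - \<beta>) * (e + T) = e + T" by (simp add: algebra_simps)
  ultimately show ?thesis by (simp only: T_def)
qed

section \<open>Reduction of \<open>A_op\<close> to upper excesses and the abstract error
  bound\<close>

definition excess :: "real \<Rightarrow> real \<Rightarrow> (real^'n::finite \<Rightarrow> real) \<Rightarrow> real^'n \<Rightarrow> real" where
  "excess p \<epsilon> f x = max (INF c\<in>{m_eps p \<epsilon>..M_eps p \<epsilon>}. up_term p \<epsilon> f x c) (f x) - f x"

lemma M_op_uminus: "M_op p \<rho> (\<lambda>y. - f y) x = - M_op p \<rho> f x"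
  by (simp add: M_op_def Let_def INF_eq_neg_SUP ball_avg_def set_lebesgue_integral_def algebra_simps)

lemma down_term_eq: "down_term p \<epsilon> f x c = - up_term p \<epsilon> (\<lambda>y. - f y) x c"
  by (simp add: down_term_def up_term_def M_op_uminus INF_eq_neg_SUP)

lemma A_op_eq_excess:
  "A_op p \<epsilon> f x = f x + 1/2 * excess p \<epsilon> f x - 1/2 * excess p \<epsilon> (\<lambda>y. - f y) x"
proof -
  let ?I = "{m_eps p \<epsilon>..M_eps p \<epsilon>}"
  have "(INF c\<in>?I. up_term p \<epsilon> (\<lambda>y. - f y) x c) = - (SUP c\<in>?I. down_term p \<epsilon> f x c)"
    by (simp add: INF_eq_neg_SUP down_term_eq)
  then show ?thesis
    by (simp add: A_op_def excess_def max_def min_def field_simps)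
qed

lemma rad2_square: "0 < c \<Longrightarrow> (rad2 p \<epsilon> c)\<^sup>2 = \<epsilon>\<^sup>2 * c powr (- alpha p)"
  by (simp add: rad2_def power_mult_distrib power2_eq_square powr_add[symmetric])

text \<open>Errors are split into two kinds: those of size \<open>\<epsilon>\<^sup>2\<close> times a
  constant go into \<open>e1\<close> and \<open>e2\<close>, while those proportional to the squared
  averaging radius go into the separate values \<open>N1\<close> and \<open>N2\<close>. The lower
  bound has to hold for every \<open>c\<close>; the upper bound needs only one good
  \<open>c\<close>.\<close>

lemma excess_bounds:
  fixes f :: "real^'n::finite \<Rightarrow> real"
  assumes p: "2 < p" and \<epsilon>: "0 < \<epsilon>" and mM: "m_eps p \<epsilon> \<le> M_eps p \<epsilon>" and G: "0 \<le> G"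
    and bdd: "bdd_below (up_term p \<epsilon> f x ` {m_eps p \<epsilon>..M_eps p \<epsilon>})"
    and e: "0 \<le> e1" "0 \<le> e2"
    and sup: "\<And>c. c \<in> {m_eps p \<epsilon>..M_eps p \<epsilon>} \<Longrightarrow>
      \<bar>(SUP y\<in>ball x (rad1 p \<epsilon> c). f y) - (f x + rad1 p \<epsilon> c * G)\<bar> \<le> \<epsilon>\<^sup>2 * e1"
    and M1: "\<And>c. c \<in> {m_eps p \<epsilon>..M_eps p \<epsilon>} \<Longrightarrow>
      f x + (rad2 p \<epsilon> c)\<^sup>2 * N1 - \<epsilon>\<^sup>2 * e2 \<le> M_op p (rad2 p \<epsilon> c) f x"
    and M2: "\<And>c. c \<in> {m_eps p \<epsilon>..M_eps p \<epsilon>} \<Longrightarrow>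
      M_op p (rad2 p \<epsilon> c) f x \<le> f x + (rad2 p \<epsilon> c)\<^sup>2 * N2 + \<epsilon>\<^sup>2 * e2"
  defines "al \<equiv> alpha p"
  shows "\<epsilon>\<^sup>2 * (envelope_min al G N1 - (e1 + e2)) \<le> excess p \<epsilon> f x"
    and "excess p \<epsilon> f x \<le> \<epsilon>\<^sup>2 * (envelope_min al G N2 + m_eps p \<epsilon> powr (1 - al) * G
      + M_eps p \<epsilon> powr (- al) * max 0 N2 + e1 + e2)"
proof -
  let ?I = "{m_eps p \<epsilon>..M_eps p \<epsilon>}"
  have al: "0 < al" "al < 1" using p by (auto simp: al_def alpha_def)
  have m: "0 < m_eps p \<epsilon>" using \<epsilon> by (simp add: m_eps_def)
  have env: "al * (rad1 p \<epsilon> c * G) + (1 - al) * ((rad2 p \<epsilon> c)\<^sup>2 * N) = \<epsilon>\<^sup>2 * envelope al G N c"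
    if "c \<in> ?I" for c N
    using that m by (simp add: rad2_square rad1_def envelope_def al_def algebra_simps)
  have up: "up_term p \<epsilon> f x c = al * (SUP y\<in>ball x (rad1 p \<epsilon> c). f y) + (1 - al) * M_op p (rad2 p \<epsilon> c) f x" for c
    by (simp add: up_term_def al_def)
  have ee: "al * (\<epsilon>\<^sup>2 * e1) + (1 - al) * (\<epsilon>\<^sup>2 * e2) \<le> \<epsilon>\<^sup>2 * (e1 + e2)"
  proof -
    have "al * (\<epsilon>\<^sup>2 * e1) \<le> 1 * (\<epsilon>\<^sup>2 * e1)" "(1 - al) * (\<epsilon>\<^sup>2 * e2) \<le> 1 * (\<epsilon>\<^sup>2 * e2)"
      using al e by (intro mult_right_mono; simp)+
    then show ?thesis by (simp add: distrib_left)
  qed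
  have upper: "up_term p \<epsilon> f x c \<le> f x + \<epsilon>\<^sup>2 * (envelope al G N2 c + e1 + e2)" if c: "c \<in> ?I" for c
  proof -
    have "al * (SUP y\<in>ball x (rad1 p \<epsilon> c). f y) \<le> al * (f x + rad1 p \<epsilon> c * G + \<epsilon>\<^sup>2 * e1)"
      using al sup[OF c] by (intro mult_left_mono) auto
    moreover have "(1 - al) * M_op p (rad2 p \<epsilon> c) f x \<le> (1 - al) * (f x + (rad2 p \<epsilon> c)\<^sup>2 * N2 + \<epsilon>\<^sup>2 * e2)"
      using al M2[OF c] by (intro mult_left_mono) auto
    ultimately show ?thesis using env[OF c, of N2] ee unfolding up by (simp add: algebra_simps)
  qed
  have lower: "f x + \<epsilon>\<^sup>2 * (envelope al G N1 c - (e1 + e2)) \<le> up_term p \<epsilon> f x c" if c: "c \<in> ?I" for c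
  proof -
    have "al * (f x + rad1 p \<epsilon> c * G - \<epsilon>\<^sup>2 * e1) \<le> al * (SUP y\<in>ball x (rad1 p \<epsilon> c). f y)"
      using al sup[OF c] by (intro mult_left_mono) auto
    moreover have "(1 - al) * (f x + (rad2 p \<epsilon> c)\<^sup>2 * N1 - \<epsilon>\<^sup>2 * e2) \<le> (1 - al) * M_op p (rad2 p \<epsilon> c) f x"
      using al M1[OF c] by (intro mult_left_mono) auto
    ultimately show ?thesis using env[OF c, of N1] ee unfolding up by (simp add: algebra_simps)
  qed
  show "\<epsilon>\<^sup>2 * (envelope_min al G N1 - (e1 + e2)) \<le> excess p \<epsilon> f x"
  \<comment> \<open>Young's inequality controls only the positive part of \<open>envelope\<close>.
    If the minimum is 0, nonnegativity of \<open>excess\<close> is enough; if it is positive, the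
    maximum with 0 must be \<open>envelope\<close> itself.\<close>
  proof (cases "envelope_min al G N1 = 0")
    case True
    then have "\<epsilon>\<^sup>2 * (envelope_min al G N1 - (e1 + e2)) \<le> 0"
      using e by (intro mult_nonneg_nonpos) auto
    also have "0 \<le> excess p \<epsilon> f x" by (simp add: excess_def)
    finally show ?thesis .
  next
    case False
    have "f x + \<epsilon>\<^sup>2 * (envelope_min al G N1 - (e1 + e2)) \<le> (INF c\<in>?I. up_term p \<epsilon> f x c)"
    proof (rule cINF_greatest)
      fix c assume c: "c \<in> ?I"
      have "envelope_min al G N1 \<le> max 0 (envelope al G N1 c)"
        using c m by (intro envelope_min_le_envelope al G) auto
      with False envelope_min_nonneg[of al G N1] have "envelope_min al G N1 \<le> envelope al G N1 c"
        by (auto simp: max_def split: if_splits)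
      then have "\<epsilon>\<^sup>2 * (envelope_min al G N1 - (e1 + e2)) \<le> \<epsilon>\<^sup>2 * (envelope al G N1 c - (e1 + e2))"
        by (intro mult_left_mono) auto
      with lower[OF c] show "f x + \<epsilon>\<^sup>2 * (envelope_min al G N1 - (e1 + e2)) \<le> up_term p \<epsilon> f x c" by linarith
    qed (use mM in auto)
    then show ?thesis by (simp add: excess_def)
  qed
  obtain c where c: "c \<in> ?I" and cl: "envelope al G N2 c \<le>
      envelope_min al G N2 + m_eps p \<epsilon> powr (1 - al) * G + M_eps p \<epsilon> powr (- al) * max 0 N2"
    using ex_envelope_le[OF al m mM G, of N2] by blast
  let ?B = "envelope_min al G N2 + m_eps p \<epsilon> powr (1 - al) * G + M_eps p \<epsilon> powr (- al) * max 0 N2 + e1 + e2"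
  have "(INF c\<in>?I. up_term p \<epsilon> f x c) \<le> up_term p \<epsilon> f x c"
    by (rule cINF_lower[OF bdd c])
  also have "\<dots> \<le> f x + \<epsilon>\<^sup>2 * (envelope al G N2 c + e1 + e2)" by (rule upper[OF c])
  also have "\<epsilon>\<^sup>2 * (envelope al G N2 c + e1 + e2) \<le> \<epsilon>\<^sup>2 * ?B"
    using cl by (intro mult_left_mono) auto
  finally have "(INF c\<in>?I. up_term p \<epsilon> f x c) \<le> f x + \<epsilon>\<^sup>2 * ?B" by simp
  moreover have "0 \<le> \<epsilon>\<^sup>2 * ?B"
    using e G envelope_min_nonneg[of al G N2] by simp
  ultimately show "excess p \<epsilon> f x \<le> \<epsilon>\<^sup>2 * ?B" by (simp add: excess_def)
qed

text \<open>The limiting value is half of the function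
  \<open>envelope_min (alpha p) G n - envelope_min (alpha p) G (- n)\<close> of n, taken at
  \<open>N\<close>. The number \<open>\<Delta>\<close> bounds its increase from \<open>N\<close> to
  \<open>N2\<close> and from \<open>N1\<close> to \<open>N\<close>, which is the effect of the
  uncertainty in \<open>N\<close>.\<close>

lemma A_op_error_bound:
  fixes f :: "real^'n::finite \<Rightarrow> real"
  assumes p: "2 < p" and \<epsilon>: "0 < \<epsilon>" and wd: "A_well_defined p \<epsilon> f x R" and G: "0 \<le> G"
    and e: "0 \<le> e1" "0 \<le> e2"
    and sup: "\<And>c. c \<in> {m_eps p \<epsilon>..M_eps p \<epsilon>} \<Longrightarrow>
      \<bar>(SUP y\<in>ball x (rad1 p \<epsilon> c). f y) - (f x + rad1 p \<epsilon> c * G)\<bar> \<le> \<epsilon>\<^sup>2 * e1"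
    and inf: "\<And>c. c \<in> {m_eps p \<epsilon>..M_eps p \<epsilon>} \<Longrightarrow>
      \<bar>(INF y\<in>ball x (rad1 p \<epsilon> c). f y) - (f x - rad1 p \<epsilon> c * G)\<bar> \<le> \<epsilon>\<^sup>2 * e1"
    and M1: "\<And>c. c \<in> {m_eps p \<epsilon>..M_eps p \<epsilon>} \<Longrightarrow>
      f x + (rad2 p \<epsilon> c)\<^sup>2 * N1 - \<epsilon>\<^sup>2 * e2 \<le> M_op p (rad2 p \<epsilon> c) f x"
    and M2: "\<And>c. c \<in> {m_eps p \<epsilon>..M_eps p \<epsilon>} \<Longrightarrow>
      M_op p (rad2 p \<epsilon> c) f x \<le> f x + (rad2 p \<epsilon> c)\<^sup>2 * N2 + \<epsilon>\<^sup>2 * e2"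
    and \<Delta>: "envelope_min (alpha p) G N2 - envelope_min (alpha p) G N
        + (envelope_min (alpha p) G (- N) - envelope_min (alpha p) G (- N2)) \<le> \<Delta>"
      "envelope_min (alpha p) G N - envelope_min (alpha p) G N1
        + (envelope_min (alpha p) G (- N1) - envelope_min (alpha p) G (- N)) \<le> \<Delta>"
    and Nm: "0 \<le> Nm" "N2 \<le> Nm" "- N1 \<le> Nm"
  shows "\<bar>(A_op p \<epsilon> f x - f x) / \<epsilon>\<^sup>2 - 1/2 * (envelope_min (alpha p) G N - envelope_min (alpha p) G (- N))\<bar>
    \<le> \<Delta> / 2 + m_eps p \<epsilon> powr (1 - alpha p) * G + M_eps p \<epsilon> powr (- alpha p) * Nm + e1 + e2"
proof -
  let ?h = "envelope_min (alpha p) G"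
  have mM: "m_eps p \<epsilon> \<le> M_eps p \<epsilon>"
    and bdd: "bdd_below (up_term p \<epsilon> f x ` {m_eps p \<epsilon>..M_eps p \<epsilon>})"
    and bda: "bdd_above (down_term p \<epsilon> f x ` {m_eps p \<epsilon>..M_eps p \<epsilon>})"
    using wd by (auto simp: A_well_defined_def)
  have bdd': "bdd_below (up_term p \<epsilon> (\<lambda>y. - f y) x ` {m_eps p \<epsilon>..M_eps p \<epsilon>})"
    using bda unfolding down_term_eq bdd_above_def bdd_below_def
    by (auto simp: ball_simps) (metis minus_le_iff atLeastAtMost_iff)
  note b = excess_bounds[OF p \<epsilon> mM G bdd e sup M1 M2]
  \<comment> \<open>Changing the sign of \<open>f\<close> exchanges lower and upper bounds, so
    \<open>- N2\<close> now plays the role of the lower value and \<open>- N1\<close> that of the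
    upper one.\<close>
  note b' = excess_bounds[where f = "\<lambda>y. - f y" and ?N1.0 = "- N2" and ?N2.0 = "- N1", OF p \<epsilon> mM G bdd' e]
  have b'1: "\<epsilon>\<^sup>2 * (?h (- N2) - (e1 + e2)) \<le> excess p \<epsilon> (\<lambda>y. - f y) x"
    and b'2: "excess p \<epsilon> (\<lambda>y. - f y) x \<le> \<epsilon>\<^sup>2 * (?h (- N1) + m_eps p \<epsilon> powr (1 - alpha p) * G
      + M_eps p \<epsilon> powr (- alpha p) * max 0 (- N1) + e1 + e2)"
    by (rule b'; use inf M1 M2 in \<open>force simp: M_op_uminus INF_eq_neg_SUP\<close>)+
  define X where "X = (excess p \<epsilon> f x) / \<epsilon>\<^sup>2"
  define Y where "Y = (excess p \<epsilon> (\<lambda>y. - f y) x) / \<epsilon>\<^sup>2"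
  define u where "u = m_eps p \<epsilon> powr (1 - alpha p) * G"
  define v where "v = M_eps p \<epsilon> powr (- alpha p)"
  have ex: "excess p \<epsilon> f x = \<epsilon>\<^sup>2 * X" "excess p \<epsilon> (\<lambda>y. - f y) x = \<epsilon>\<^sup>2 * Y"
    using \<epsilon> by (auto simp: X_def Y_def)
  have cancel: "\<epsilon>\<^sup>2 * a \<le> \<epsilon>\<^sup>2 * b \<longleftrightarrow> a \<le> b" for a b :: real using \<epsilon> by simp
  have v: "0 \<le> v" and u: "0 \<le> u" using G by (auto simp: v_def u_def)
  have mx: "v * max 0 N2 \<le> v * Nm" "v * max 0 (- N1) \<le> v * Nm" "0 \<le> v * Nm"
    using Nm v by (auto intro!: mult_left_mono)
  define w where "w = v * Nm"
  have "?h N1 - (e1 + e2) \<le> X" "X \<le> ?h N2 + u + v * max 0 N2 + e1 + e2"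
    "?h (- N2) - (e1 + e2) \<le> Y" "Y \<le> ?h (- N1) + u + v * max 0 (- N1) + e1 + e2"
    using b b'1 b'2 unfolding ex cancel u_def v_def by auto
  then have "?h N1 - (e1 + e2) \<le> X" "X \<le> ?h N2 + u + w + e1 + e2"
    "?h (- N2) - (e1 + e2) \<le> Y" "Y \<le> ?h (- N1) + u + w + e1 + e2"
    using mx unfolding w_def by simp_all
  moreover have "(A_op p \<epsilon> f x - f x) / \<epsilon>\<^sup>2 = 1/2 * X - 1/2 * Y"
    using \<epsilon> by (simp add: A_op_eq_excess ex field_simps)
  ultimately show ?thesis
    using mx(3) \<Delta> u e unfolding u_def[symmetric] v_def[symmetric] w_def[symmetric]
    by (simp add: abs_le_iff field_simps)
qed

text \<open>The exponents match because 1 / (p - 1) = 1 - \<alpha> and (p - 2)(1 - \<alpha>) =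
  \<alpha>. The two envelope values carry the positive and the negative part of \<open>N\<close>,
  and at least one of them is always 0. At a critical point both sides vanish.\<close>

lemma spow_p_laplacian:
  fixes f :: "real^'n::finite \<Rightarrow> real"
  assumes p: "2 < p" and f: "Ck_on 2 S f" "x \<in> S"
  defines "N \<equiv> normalized_p_lap p (grad f x) (D2 f x)" and "G \<equiv> norm (grad f x)"
  shows "spow (p_laplacian p f x) (1 / (p - 1)) =
    envelope_min (alpha p) G N - envelope_min (alpha p) G (- N)"
proof (cases "grad f x = 0")
  case True
  then show ?thesis
    using p p_laplacian_grad_eq_0[OF p f] by (simp add: spow_def envelope_min_def G_def)
next
  case False
  then have G: "0 < G" by (simp add: G_def)
  have L: "p_laplacian p f x = G powr (p - 2) * N"
    using p_laplacian_grad_neq_0[OF p f False] by (simp add: G_def N_def normalized_p_lap_def)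
  have q: "1 / (p - 1) = 1 - alpha p" using p by (simp add: alpha_def field_simps)
  have "(p - 2) * (1 - alpha p) = alpha p" using p by (simp add: alpha_def field_simps)
  then have "(G powr (p - 2) * \<bar>N\<bar>) powr (1 - alpha p) = G powr alpha p * \<bar>N\<bar> powr (1 - alpha p)"
    using G by (simp add: powr_mult powr_powr)
  moreover have "sgn (G powr (p - 2) * N) = sgn N" using G by (simp add: sgn_mult)
  ultimately show ?thesis
    unfolding L q spow_def using G
    by (cases N "0::real" rule: linorder_cases) (auto simp: envelope_min_def abs_mult max_def)
qed

section \<open>Radii and well-definedness\<close>

lemma one_minus_alpha: "2 < p \<Longrightarrow> 1 - alpha p = 1 / (p - 1)"
  by (simp add: alpha_def field_simps)

lemma m_eps_powr: "2 < p \<Longrightarrow> m_eps p \<epsilon> powr (1 - alpha p) = \<epsilon> powr (2 / (3 * p - 4))"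
proof -
  assume p: "2 < p"
  have "2 * (p - 1) / (3 * p - 4) * (1 / (p - 1)) = 2 / (3 * p - 4)"
    using p by (simp add: divide_simps; simp add: algebra_simps)
  then show ?thesis by (simp only: m_eps_def powr_powr one_minus_alpha[OF p])
qed

lemma M_eps_powr:
  assumes "2 < p"
  shows "M_eps p \<epsilon> powr (- alpha p) = \<epsilon> powr (2 - 4 / p)"
proof -
  have "(- 2 + 2 / p) * (- alpha p) = 2 - 4 / p"
    using assms by (simp add: alpha_def field_simps power2_eq_square)
  then show ?thesis by (simp add: M_eps_def powr_powr)
qed

lemma square_mult_powr: "0 < \<epsilon> \<Longrightarrow> \<epsilon>\<^sup>2 * \<epsilon> powr a = \<epsilon> powr (2 + a)" for \<epsilon> :: real
  by (simp add: powr_add)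

lemma m_eps_pos: "0 < \<epsilon> \<Longrightarrow> 0 < m_eps p \<epsilon>"
  by (simp add: m_eps_def)

lemma m_eps_le_M_eps:
  assumes "2 < p" "0 < \<epsilon>" "\<epsilon> < 1"
  shows "m_eps p \<epsilon> \<le> M_eps p \<epsilon>"
  unfolding m_eps_def M_eps_def
proof (rule powr_mono')
  have "- 2 + 2 / p \<le> 0" using assms by (simp add: field_simps)
  also have "0 \<le> 2 * (p - 1) / (3 * p - 4)" using assms by (intro divide_nonneg_nonneg) auto
  finally show "- 2 + 2 / p \<le> 2 * (p - 1) / (3 * p - 4)" .
qed (use assms in auto)

text \<open>This radius increases with \<open>c\<close>, so the worst case is the right endpoint
  \<open>M_eps\<close>.\<close>

lemma rad1_le:
  assumes p: "2 < p" and \<epsilon>: "0 < \<epsilon>" and c: "c \<in> {m_eps p \<epsilon>..M_eps p \<epsilon>}"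
  shows "rad1 p \<epsilon> c \<le> \<epsilon> powr (2 - 2 / p)"
proof -
  have "0 \<le> 1 - alpha p" using p by (simp add: one_minus_alpha)
  then have "c powr (1 - alpha p) \<le> M_eps p \<epsilon> powr (1 - alpha p)"
    using c m_eps_pos[OF \<epsilon>, of p] by (intro powr_mono2) auto
  also have "\<dots> = \<epsilon> powr (- 2 / p)"
  proof -
    have "(- 2 + 2 / p) * (1 / (p - 1)) = - 2 / p" using p by (simp add: field_simps)
    then show ?thesis using p by (simp add: M_eps_def powr_powr one_minus_alpha)
  qed
  finally have "rad1 p \<epsilon> c \<le> \<epsilon>\<^sup>2 * \<epsilon> powr (- 2 / p)"
    unfolding rad1_def by (intro mult_left_mono) auto
  also have "\<dots> = \<epsilon> powr (2 - 2 / p)"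
    using square_mult_powr[OF \<epsilon>, of "- 2 / p"] by simp
  finally show ?thesis .
qed

text \<open>This radius decreases with \<open>c\<close>, so the worst case is the left endpoint
  \<open>m_eps\<close>. The resulting exponent is below 1: the averaging balls are much larger than
  \<epsilon>, although they still shrink to a point.\<close>

lemma rad2_le:
  assumes p: "2 < p" and \<epsilon>: "0 < \<epsilon>" and c: "c \<in> {m_eps p \<epsilon>..M_eps p \<epsilon>}"
  shows "rad2 p \<epsilon> c \<le> \<epsilon> powr ((2 * p - 2) / (3 * p - 4))"
proof -
  have "- alpha p / 2 \<le> 0" using p by (simp add: alpha_def)
  then have "c powr (- alpha p / 2) \<le> m_eps p \<epsilon> powr (- alpha p / 2)"
    using c m_eps_pos[OF \<epsilon>, of p] by (intro powr_mono2') auto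
  also have "\<dots> = \<epsilon> powr (- (p - 2) / (3 * p - 4))"
  proof -
    have "2 * (p - 1) / (3 * p - 4) * (- alpha p / 2) = - (p - 2) / (3 * p - 4)"
      using p by (simp add: alpha_def divide_simps) (simp add: algebra_simps)
    then show ?thesis by (simp only: m_eps_def powr_powr)
  qed
  finally have "rad2 p \<epsilon> c \<le> \<epsilon> powr 1 * \<epsilon> powr (- (p - 2) / (3 * p - 4))"
    unfolding rad2_def using \<epsilon> by (intro mult_mono) auto
  also have "\<dots> = \<epsilon> powr ((2 * p - 2) / (3 * p - 4))"
  proof -
    have "1 + - (p - 2) / (3 * p - 4) = (2 * p - 2) / (3 * p - 4)" using p by (simp add: field_simps)
    then show ?thesis by (simp only: powr_add[symmetric])
  qed
  finally show ?thesis .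
qed

lemma rad_pos:
  assumes "0 < \<epsilon>" "c \<in> {m_eps p \<epsilon>..M_eps p \<epsilon>}"
  shows "0 < rad1 p \<epsilon> c" "0 < rad2 p \<epsilon> c"
  using assms m_eps_pos[of \<epsilon> p] by (auto simp: rad1_def rad2_def)

text \<open>The second factor is \<open>M_eps p \<epsilon> powr (- alpha p)\<close>. Solving
  \<open>(rad1 p \<epsilon> M)\<^sup>2 = \<epsilon>\<^sup>2 * M powr (- alpha p)\<close> for
  \<open>M\<close> gives the definition of \<open>M_eps\<close>.\<close>

lemma rad1_square_le:
  assumes p: "2 < p" and \<epsilon>: "0 < \<epsilon>" and c: "c \<in> {m_eps p \<epsilon>..M_eps p \<epsilon>}"
  shows "(rad1 p \<epsilon> c)\<^sup>2 \<le> \<epsilon>\<^sup>2 * \<epsilon> powr (2 - 4 / p)"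
proof -
  have "(rad1 p \<epsilon> c)\<^sup>2 \<le> (\<epsilon> powr (2 - 2 / p))\<^sup>2"
    using rad1_le[OF assms] rad_pos[OF \<epsilon> c] by (intro power_mono) auto
  also have "\<dots> = \<epsilon> powr (2 + (2 - 4 / p))"
    by (simp add: power2_eq_square powr_add[symmetric])
  also have "\<dots> = \<epsilon>\<^sup>2 * \<epsilon> powr (2 - 4 / p)"
    by (rule square_mult_powr[OF \<epsilon>, symmetric])
  finally show ?thesis .
qed

text \<open>The second factor is \<open>m_eps p \<epsilon> powr (1 - alpha p)\<close>. Solving
  \<open>rad2 p \<epsilon> m ^ 3 = \<epsilon>\<^sup>2 * m powr (1 - alpha p)\<close> for
  \<open>m\<close> gives the definition of \<open>m_eps\<close>.\<close>

lemma rad2_cube_le: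
  assumes p: "2 < p" and \<epsilon>: "0 < \<epsilon>" and c: "c \<in> {m_eps p \<epsilon>..M_eps p \<epsilon>}"
  shows "rad2 p \<epsilon> c ^ 3 \<le> \<epsilon>\<^sup>2 * \<epsilon> powr (2 / (3 * p - 4))"
proof -
  have "rad2 p \<epsilon> c ^ 3 \<le> (\<epsilon> powr ((2 * p - 2) / (3 * p - 4))) ^ 3"
    using rad2_le[OF assms] rad_pos[OF \<epsilon> c] by (intro power_mono) auto
  also have "\<dots> = \<epsilon> powr (2 + 2 / (3 * p - 4))"
  proof -
    have e: "(2 * p - 2) / (3 * p - 4) * 3 = 2 + 2 / (3 * p - 4)" using p by (simp add: field_simps)
    have "(\<epsilon> powr ((2 * p - 2) / (3 * p - 4))) ^ 3 = \<epsilon> powr ((2 * p - 2) / (3 * p - 4) * 3)"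
      by (subst powr_realpow[symmetric]) (use \<epsilon> in \<open>simp_all add: powr_powr\<close>)
    then show ?thesis unfolding e .
  qed
  also have "\<dots> = \<epsilon>\<^sup>2 * \<epsilon> powr (2 / (3 * p - 4))"
    by (rule square_mult_powr[OF \<epsilon>, symmetric])
  finally show ?thesis .
qed

lemma gamma_pos: "2 < p \<Longrightarrow> 0 < gamma p d"
  by (simp add: gamma_def)

lemma balls_insideI:
  assumes p: "2 < p" and \<epsilon>: "0 < \<epsilon>" and r: "\<epsilon> powr (2 - 2 / p) \<le> r"
    "gamma p CARD('n) * \<epsilon> powr ((2 * p - 2) / (3 * p - 4)) \<le> r"
  shows "balls_inside p \<epsilon> (x::real^'n::finite) r"
  unfolding balls_inside_def
proof (intro ballI conjI subset_ball)
  fix c assume c: "c \<in> {m_eps p \<epsilon>..M_eps p \<epsilon>}"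
  show "rad1 p \<epsilon> c \<le> r" using rad1_le[OF p \<epsilon> c] r by linarith
  have "gamma p CARD('n) * rad2 p \<epsilon> c \<le> gamma p CARD('n) * \<epsilon> powr ((2 * p - 2) / (3 * p - 4))"
    using gamma_pos[OF p, of "CARD('n)"] by (intro mult_left_mono rad2_le[OF p \<epsilon> c]) auto
  then show "gamma p CARD('n) * rad2 p \<epsilon> c \<le> r" using r by linarith
qed

lemma eventually_balls_inside:
  fixes x :: "real^'n::finite"
  assumes p: "2 < p" and r: "0 < r"
  shows "\<forall>\<^sub>F \<epsilon> in at_right 0. balls_inside p \<epsilon> x r"
proof -
  have 0: "\<forall>\<^sub>F \<epsilon>::real in at_right 0. 0 \<le> \<epsilon>"
    using eventually_at_right_less[of "0::real"] by eventually_elim simp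
  have "((\<lambda>\<epsilon>::real. \<epsilon> powr (2 - 2 / p)) \<longlongrightarrow> 0) (at_right 0)"
    using p by (intro tendsto_zero_powrI[where f = "\<lambda>x. x"] tendsto_intros 0) (auto simp: field_simps)
  then have 1: "\<forall>\<^sub>F \<epsilon>::real in at_right 0. \<epsilon> powr (2 - 2 / p) < r"
    by (rule order_tendstoD) (rule r)
  have "((\<lambda>\<epsilon>::real. gamma p CARD('n) * \<epsilon> powr ((2 * p - 2) / (3 * p - 4))) \<longlongrightarrow> 0) (at_right 0)"
    using p by (intro tendsto_mult_right_zero tendsto_zero_powrI[where f = "\<lambda>x. x"] tendsto_intros 0) auto
  then have 2: "\<forall>\<^sub>F \<epsilon>::real in at_right 0. gamma p CARD('n) * \<epsilon> powr ((2 * p - 2) / (3 * p - 4)) < r"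
    by (rule order_tendstoD) (rule r)
  have 3: "\<forall>\<^sub>F \<epsilon>::real in at_right 0. 0 < \<epsilon>" by (rule eventually_at_right_less)
  from 1 2 3 show ?thesis
    by eventually_elim (intro balls_insideI[OF p]; simp)
qed

section \<open>Bounded measurable functions and well-definedness\<close>

lemma set_integrable_bounded_ball:
  fixes f :: "real^'n::finite \<Rightarrow> real"
  assumes f: "f \<in> borel_measurable (lebesgue_on (ball x r))" and b: "\<And>y. y \<in> ball x r \<Longrightarrow> \<bar>f y\<bar> \<le> B"
    and sub: "ball x s \<subseteq> ball x r"
  shows "set_integrable lebesgue (ball x s) f"
    and "\<bar>set_lebesgue_integral lebesgue (ball x s) f\<bar> \<le> B * measure lebesgue (ball x s)"
proof -
  have m: "(\<lambda>y. indicator (ball x r) y *\<^sub>R f y) \<in> borel_measurable lebesgue"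
    using f borel_measurable_restrict_space_iff[of "ball x r" lebesgue f] by simp
  have B: "set_integrable lebesgue (ball x s) (\<lambda>_. B)" for s B
    unfolding set_integrable_def
    by (intro integrable_scaleR_left integrable_real_indicator)
      (auto simp: emeasure_lborel_ball_finite[unfolded infinity_ennreal_def])
  have "set_integrable lebesgue (ball x r) f"
    unfolding set_integrable_def
  proof (rule Bochner_Integration.integrable_bound[OF _ m])
    show "integrable lebesgue (\<lambda>y. indicator (ball x r) y *\<^sub>R B)"
      using B[of r B] by (simp add: set_integrable_def)
    show "AE y in lebesgue. norm (indicator (ball x r) y *\<^sub>R f y) \<le> norm (indicator (ball x r) y *\<^sub>R B)"
    proof (rule AE_I2)
      fix y
      show "norm (indicator (ball x r) y *\<^sub>R f y) \<le> norm (indicator (ball x r) y *\<^sub>R B)"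
        using b[of y] by (cases "y \<in> ball x r") auto
    qed
  qed
  then show i: "set_integrable lebesgue (ball x s) f"
    by (rule set_integrable_subset[OF _ _ sub]) simp
  have "\<bar>set_lebesgue_integral lebesgue (ball x s) f\<bar> \<le> (LINT y:ball x s|lebesgue. \<bar>f y\<bar>)"
    using set_integral_norm_bound[OF i] by simp
  also have "\<dots> \<le> (LINT y:ball x s|lebesgue. B)"
    by (rule set_integral_mono[OF set_integrable_abs[OF i] B]) (use b sub in blast)
  also have "\<dots> = B * measure lebesgue (ball x s)"
    by (simp add: set_lebesgue_integral_def)
  finally show "\<bar>set_lebesgue_integral lebesgue (ball x s) f\<bar> \<le> B * measure lebesgue (ball x s)" .
qed

text \<open>As 0 \<le> \<beta> \<le> 1, the operator is a convex combination of the midrange and the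
  mean. The bound does not depend on \<open>\<rho>\<close>, which makes the outer infimum and
  supremum over \<open>c\<close> finite.\<close>

lemma abs_M_op_le:
  fixes f :: "real^'n::finite \<Rightarrow> real"
  assumes p: "2 < p" and f: "f \<in> borel_measurable (lebesgue_on (ball x r))"
    and b: "\<And>y. y \<in> ball x r \<Longrightarrow> \<bar>f y\<bar> \<le> B"
    and \<rho>: "0 < \<rho>" and sub: "ball x (gamma p CARD('n) * \<rho>) \<subseteq> ball x r"
  shows "\<bar>M_op p \<rho> f x\<bar> \<le> B"
proof -
  define s where "s = gamma p CARD('n) * \<rho>"
  define \<beta> where "\<beta> = beta p CARD('n)"
  have s: "0 < s" using gamma_pos[OF p] \<rho> by (simp add: s_def)
  have \<beta>: "0 \<le> \<beta>" "\<beta> \<le> 1" using p by (auto simp: \<beta>_def beta_def field_simps)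
  have b': "\<bar>f y\<bar> \<le> B" if "y \<in> ball x s" for y using b sub that unfolding s_def by blast
  have ne: "ball x s \<noteq> {}" using s by auto
  have S: "\<bar>SUP y\<in>ball x s. f y\<bar> \<le> B" by (rule cSup_abs_le) (use ne b' in auto)
  have I: "\<bar>INF y\<in>ball x s. f y\<bar> \<le> B" by (rule cInf_abs_ge) (use ne b' in auto)
  have V: "0 < measure lebesgue (ball x s)" using s by (simp add: content_ball_pos)
  have avg: "\<bar>ball_avg s f x\<bar> \<le> B"
    using set_integrable_bounded_ball(2)[OF f b sub, folded s_def] V
    by (simp add: ball_avg_def abs_mult pos_divide_le_eq)
  have "\<bar>M_op p \<rho> f x\<bar> = \<bar>\<beta> * (((SUP y\<in>ball x s. f y) + (INF y\<in>ball x s. f y)) / 2) + (1 - \<beta>) * ball_avg s f x\<bar>"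
    by (simp add: M_op_def Let_def s_def \<beta>_def)
  also have "\<dots> \<le> \<beta> * \<bar>((SUP y\<in>ball x s. f y) + (INF y\<in>ball x s. f y)) / 2\<bar> + (1 - \<beta>) * \<bar>ball_avg s f x\<bar>"
    using \<beta> by (intro order_trans[OF abs_triangle_ineq]) (simp add: abs_mult)
  also have "\<dots> \<le> \<beta> * B + (1 - \<beta>) * B"
    using \<beta> S I avg by (intro add_mono mult_left_mono) auto
  finally show ?thesis by (simp add: algebra_simps)
qed

text \<open>Two radii occur because a C^2 function on the open ball of radius \<open>R\<close> may
  be unbounded near its boundary. Such functions are handled with \<open>r < R\<close>, bounded
  measurable ones with \<open>r = R\<close>.\<close>

lemma A_well_definedI:
  fixes f :: "real^'n::finite \<Rightarrow> real"
  assumes p: "2 < p" and \<epsilon>: "0 < \<epsilon>" "\<epsilon> < 1" and bi: "balls_inside p \<epsilon> x r" and r: "r \<le> R"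
    and f: "f \<in> borel_measurable (lebesgue_on (ball x r))" and b: "bounded (f ` ball x r)"
  shows "A_well_defined p \<epsilon> f x R"
proof -
  let ?I = "{m_eps p \<epsilon>..M_eps p \<epsilon>}"
  obtain B where B: "\<And>y. y \<in> ball x r \<Longrightarrow> \<bar>f y\<bar> \<le> B"
    using b unfolding bounded_iff by (metis imageI real_norm_def)
  have sub: "ball x (rad1 p \<epsilon> c) \<subseteq> ball x r" "ball x (gamma p CARD('n) * rad2 p \<epsilon> c) \<subseteq> ball x r"
    if "c \<in> ?I" for c using bi that by (auto simp: balls_inside_def)
  have rR: "ball x r \<subseteq> ball x R" using r by auto
  have al: "0 \<le> alpha p" "alpha p \<le> 1" using p by (auto simp: alpha_def)
  have bs: "bounded (f ` ball x (rad1 p \<epsilon> c))" "bounded (f ` ball x (gamma p CARD('n) * rad2 p \<epsilon> c))"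
    if "c \<in> ?I" for c
    by (rule bounded_subset[OF b image_mono[OF sub(1)[OF that]]]
        bounded_subset[OF b image_mono[OF sub(2)[OF that]]])+
  have tb: "\<bar>up_term p \<epsilon> f x c\<bar> \<le> B \<and> \<bar>down_term p \<epsilon> f x c\<bar> \<le> B" if c: "c \<in> ?I" for c
  proof -
    note pos = rad_pos[OF \<epsilon>(1) c]
    have b': "\<bar>f y\<bar> \<le> B" if "y \<in> ball x (rad1 p \<epsilon> c)" for y using B sub(1)[OF c] that by blast
    have ne: "ball x (rad1 p \<epsilon> c) \<noteq> {}" using pos by auto
    have S: "\<bar>SUP y\<in>ball x (rad1 p \<epsilon> c). f y\<bar> \<le> B"
      by (rule cSup_abs_le) (use ne b' in auto)
    have I: "\<bar>INF y\<in>ball x (rad1 p \<epsilon> c). f y\<bar> \<le> B"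
      by (rule cInf_abs_ge) (use ne b' in auto)
    have M: "\<bar>M_op p (rad2 p \<epsilon> c) f x\<bar> \<le> B"
      by (rule abs_M_op_le[OF p f B pos(2) sub(2)[OF c]])
    have "\<bar>alpha p * u + (1 - alpha p) * v\<bar> \<le> B" if "\<bar>u\<bar> \<le> B" "\<bar>v\<bar> \<le> B" for u v
    proof -
      have "\<bar>alpha p * u + (1 - alpha p) * v\<bar> \<le> alpha p * \<bar>u\<bar> + (1 - alpha p) * \<bar>v\<bar>"
        using al by (intro order_trans[OF abs_triangle_ineq]) (simp add: abs_mult)
      also have "\<dots> \<le> alpha p * B + (1 - alpha p) * B"
        using al that by (intro add_mono mult_left_mono) auto
      finally show ?thesis by (simp add: algebra_simps)
    qed
    with S I M show ?thesis unfolding up_term_def down_term_def by blast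
  qed
  have "bdd_below (up_term p \<epsilon> f x ` ?I)"
    using tb by (intro bdd_belowI2[where m = "- B"]) (meson abs_le_D2 minus_le_iff)
  moreover have "bdd_above (down_term p \<epsilon> f x ` ?I)"
    using tb by (intro bdd_aboveI2[where M = B]) (meson abs_le_D1)
  moreover have "balls_inside p \<epsilon> x R" using bi rR unfolding balls_inside_def by blast
  ultimately show ?thesis
    unfolding A_well_defined_def
    using m_eps_le_M_eps[OF p \<epsilon>] rad_pos[OF \<epsilon>(1)] gamma_pos[OF p, of "CARD('n)"] bs
      set_integrable_bounded_ball(1)[OF f B sub(2)]
    by (intro conjI ballI mult_pos_pos) auto
qed

section \<open>Error estimates\<close>

lemma Ck_on_2_A_well_defined:
  fixes f :: "real^'n::finite \<Rightarrow> real"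
  assumes p: "2 < p" and \<epsilon>: "0 < \<epsilon>" "\<epsilon> < 1" and f: "Ck_on 2 (ball x R) f"
    and r: "r < R" and bi: "balls_inside p \<epsilon> x r"
  shows "A_well_defined p \<epsilon> f x R"
proof (rule A_well_definedI[OF p \<epsilon> bi])
  have sub: "cball x r \<subseteq> ball x R" using r by auto
  have c: "continuous_on (cball x r) f"
    by (rule continuous_on_subset[OF Ck_on_imp_continuous_on[OF f] sub])
  show "f \<in> borel_measurable (lebesgue_on (ball x r))"
    by (rule continuous_imp_measurable_on_sets_lebesgue[OF continuous_on_subset[OF c]]) auto
  have "bounded (f ` cball x r)"
    by (intro compact_imp_bounded compact_continuous_image c) auto
  then show "bounded (f ` ball x r)" by (rule bounded_subset) auto
qed (use r in simp)

text \<open>On these small balls the whole second order part is an admissible error, so the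
  expansion uses the matrix 0. That choice also removes the cubic remainder and covers a vanishing
  gradient.\<close>

lemma rad1_approx:
  fixes f :: "real^'n::finite \<Rightarrow> real"
  assumes p: "2 < p" and \<epsilon>: "0 < \<epsilon>" and f: "Ck_on 2 (ball x R) f"
    and r: "r < R" and bi: "balls_inside p \<epsilon> x r"
    and K: "\<And>y. y \<in> ball x r \<Longrightarrow> norm (D2 f y) \<le> K" "0 \<le> K"
    and c: "c \<in> {m_eps p \<epsilon>..M_eps p \<epsilon>}"
  defines "e \<equiv> \<epsilon>\<^sup>2 * (1/2 * K * \<epsilon> powr (2 - 4 / p))"
  shows "\<bar>(SUP y\<in>ball x (rad1 p \<epsilon> c). f y) - (f x + rad1 p \<epsilon> c * norm (grad f x))\<bar> \<le> e"
    and "\<bar>(INF y\<in>ball x (rad1 p \<epsilon> c). f y) - (f x - rad1 p \<epsilon> c * norm (grad f x))\<bar> \<le> e"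
proof -
  let ?s = "rad1 p \<epsilon> c"
  have s: "0 < ?s" by (rule rad_pos[OF \<epsilon> c])
  have sub: "ball x ?s \<subseteq> ball x r" using bi c by (auto simp: balls_inside_def)
  have sub': "ball x ?s \<subseteq> ball x R" by (rule order_trans[OF sub]) (use r in auto)
  have w: "norm (D2 f y - 0) \<le> K" if "y \<in> ball x ?s" for y using K(1) sub that by auto
  have a: "\<bar>f (x + h) - (f x + grad f x \<bullet> h + 1/2 * (h \<bullet> ((0::real^'n^'n) *v h)))\<bar> \<le> 1/2 * K * ?s\<^sup>2"
    if "norm h < ?s" for h
    by (rule taylor_second_order[OF f sub' that w])
  have "1/2 * K * ?s\<^sup>2 \<le> 1/2 * K * (\<epsilon>\<^sup>2 * \<epsilon> powr (2 - 4 / p))"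
    using K(2) by (intro mult_left_mono rad1_square_le[OF p \<epsilon> c]) auto
  then have e: "1/2 * K * ?s\<^sup>2 \<le> e" by (simp add: e_def mult_ac)
  have g: "grad f x \<noteq> 0 \<or> (0::real^'n^'n) = 0" by simp
  show "\<bar>(SUP y\<in>ball x ?s. f y) - (f x + ?s * norm (grad f x))\<bar> \<le> e"
    using SUP_ball_approx[OF s g a] e by (simp add: abs_le_iff)
  show "\<bar>(INF y\<in>ball x ?s. f y) - (f x - ?s * norm (grad f x))\<bar> \<le> e"
    using INF_ball_approx[OF s g a] e by (simp add: abs_le_iff)
qed

lemma rad2_approx:
  fixes f :: "real^'n::finite \<Rightarrow> real"
  assumes p: "2 < p" and \<epsilon>: "0 < \<epsilon>" "\<epsilon> < 1" and f: "Ck_on 2 (ball x R) f"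
    and r: "r < R" and bi: "balls_inside p \<epsilon> x r"
    and c: "c \<in> {m_eps p \<epsilon>..M_eps p \<epsilon>}"
  defines "s \<equiv> gamma p CARD('n) * rad2 p \<epsilon> c"
  assumes w: "\<And>y. y \<in> ball x s \<Longrightarrow> norm (D2 f y - A) \<le> w"
    and A: "grad f x \<noteq> 0 \<or> A = 0"
  shows "\<bar>M_op p (rad2 p \<epsilon> c) f x - (f x + (rad2 p \<epsilon> c)\<^sup>2 * normalized_p_lap p (grad f x) A)\<bar>
    \<le> 1/2 * w * s\<^sup>2 + s ^ 3 * (norm A)\<^sup>2 / (2 * norm (grad f x))"
proof -
  have sub: "ball x s \<subseteq> ball x r" using bi c by (auto simp: balls_inside_def s_def)
  have sub': "ball x s \<subseteq> ball x R" by (rule order_trans[OF sub]) (use r in auto)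
  have i: "set_integrable lebesgue (ball x s) f"
    using Ck_on_2_A_well_defined[OF p \<epsilon> f r bi] c by (simp add: A_well_defined_def s_def)
  show ?thesis
    by (rule M_op_approx[OF p rad_pos(2)[OF \<epsilon>(1) c] A, of x f, folded s_def, OF i])
      (rule taylor_second_order[OF f sub' _ w])
qed

text \<open>The expansion of the theorem solved for E. It involves no radius, so one function serves
  all choices of balls in the estimates.\<close>

definition A_op_error :: "real \<Rightarrow> (real^'n::finite \<Rightarrow> real) \<Rightarrow> real^'n \<Rightarrow> real \<Rightarrow> real" where
  "A_op_error p f x \<epsilon> = (A_op p \<epsilon> f x - f x) / \<epsilon>\<^sup>2 - 1/2 * spow (p_laplacian p f x) (1 / (p - 1))"

text \<open>The sup and inf terms are settled here once and for all; their error K/2 has the same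
  power of \<open>\<epsilon>\<close> as the cutoff at \<open>M_eps\<close> and joins it. Each
  estimate below then only has to enclose \<open>M_op\<close>.\<close>

lemma abs_A_op_error_le:
  fixes f :: "real^'n::finite \<Rightarrow> real"
  assumes p: "2 < p" and \<epsilon>: "0 < \<epsilon>" "\<epsilon> < 1" and f: "Ck_on 2 (ball x R) f"
    and r: "0 < r" "r < R" and bi: "balls_inside p \<epsilon> x r"
    and K: "\<And>y. y \<in> ball x r \<Longrightarrow> norm (D2 f y) \<le> K"
    and e: "0 \<le> e"
  defines "N \<equiv> normalized_p_lap p (grad f x) (D2 f x)" and "G \<equiv> norm (grad f x)"
  assumes M1: "\<And>c. c \<in> {m_eps p \<epsilon>..M_eps p \<epsilon>} \<Longrightarrow>
      f x + (rad2 p \<epsilon> c)\<^sup>2 * N1 - \<epsilon>\<^sup>2 * e \<le> M_op p (rad2 p \<epsilon> c) f x"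
    and M2: "\<And>c. c \<in> {m_eps p \<epsilon>..M_eps p \<epsilon>} \<Longrightarrow>
      M_op p (rad2 p \<epsilon> c) f x \<le> f x + (rad2 p \<epsilon> c)\<^sup>2 * N2 + \<epsilon>\<^sup>2 * e"
    and \<Delta>: "envelope_min (alpha p) G N2 - envelope_min (alpha p) G N
        + (envelope_min (alpha p) G (- N) - envelope_min (alpha p) G (- N2)) \<le> \<Delta>"
      "envelope_min (alpha p) G N - envelope_min (alpha p) G N1
        + (envelope_min (alpha p) G (- N1) - envelope_min (alpha p) G (- N)) \<le> \<Delta>"
    and Nm: "0 \<le> Nm" "N2 \<le> Nm" "- N1 \<le> Nm"
  shows "\<bar>A_op_error p f x \<epsilon>\<bar>
    \<le> \<Delta> / 2 + \<epsilon> powr (2 / (3 * p - 4)) * G + \<epsilon> powr (2 - 4 / p) * (Nm + K / 2) + e"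
proof -
  have x: "x \<in> ball x R" using r by simp
  have "norm (D2 f x) \<le> K" using K r by simp
  then have K0: "0 \<le> K" using norm_ge_zero[of "D2 f x"] by linarith
  have "\<bar>A_op_error p f x \<epsilon>\<bar> \<le> \<Delta> / 2 + m_eps p \<epsilon> powr (1 - alpha p) * G
     + M_eps p \<epsilon> powr (- alpha p) * Nm + 1/2 * K * \<epsilon> powr (2 - 4 / p) + e"
    unfolding A_op_error_def spow_p_laplacian[OF p f x, folded N_def G_def]
    by (rule A_op_error_bound[OF p \<epsilon>(1) Ck_on_2_A_well_defined[OF p \<epsilon> f r(2) bi] _ _ e
        rad1_approx[OF p \<epsilon>(1) f r(2) bi K K0, folded G_def] M1 M2 \<Delta> Nm])
      (use K0 in \<open>simp_all add: G_def\<close>)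
  then show ?thesis
    by (simp add: m_eps_powr[OF p] M_eps_powr[OF p] algebra_simps)
qed

lemma envelope_min_mono:
  assumes "al < 1" "N \<le> N'"
  shows "envelope_min al G N \<le> envelope_min al G N'"
  unfolding envelope_min_def using assms by (intro mult_right_mono powr_mono2) auto

lemma isCont_envelope_min: "al < 1 \<Longrightarrow> isCont (envelope_min al G) N"
  unfolding envelope_min_def isCont_def
  by (intro tendsto_intros tendsto_powr') auto

lemma alpha_less_1: "2 < p \<Longrightarrow> alpha p < 1"
  by (simp add: alpha_def)

text \<open>Expanding with the matrix 0 encloses \<open>M_op\<close> between the values for
  \<open>N1 = - (C * K)\<close> and \<open>N2 = C * K\<close> with no further error. The uncertainty
  \<open>\<Delta>\<close> is then twice \<open>envelope_min\<close> at \<open>C * K\<close>, whose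
  product form is the first term of the bound.\<close>

lemma A_op_error_bound_crude:
  fixes f :: "real^'n::finite \<Rightarrow> real"
  assumes p: "2 < p" and \<epsilon>: "0 < \<epsilon>" "\<epsilon> < 1" and f: "Ck_on 2 (ball x R) f"
    and r: "0 < r" "r < R" and bi: "balls_inside p \<epsilon> x r"
    and K: "\<And>y. y \<in> ball x r \<Longrightarrow> norm (D2 f y) \<le> K"
  defines "C \<equiv> p + CARD('n)"
  shows "\<bar>A_op_error p f x \<epsilon>\<bar> \<le> (C powr (1 / (p - 1)) + C + 1) *
    (K powr (1 / (p - 1)) * norm (grad f x) powr ((p - 2) / (p - 1))
      + \<epsilon> powr (2 - 4 / p) * K + \<epsilon> powr (2 / (3 * p - 4)) * norm (grad f x))"
proof -
  define G where "G = norm (grad f x)"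
  define N where "N = normalized_p_lap p (grad f x) (D2 f x)"
  let ?h = "envelope_min (alpha p) G"
  have C: "0 < C" using p by (simp add: C_def)
  have Hx: "norm (D2 f x) \<le> K" using K r by simp
  then have K0: "0 \<le> K" using norm_ge_zero[of "D2 f x"] by linarith
  have "\<bar>N\<bar> \<le> C * norm (D2 f x)" unfolding N_def C_def by (rule abs_normalized_p_lap_le[OF p])
  also have "\<dots> \<le> C * K" using Hx C by simp
  finally have N: "\<bar>N\<bar> \<le> C * K" .
  have M: "\<bar>M_op p (rad2 p \<epsilon> c) f x - f x\<bar> \<le> (rad2 p \<epsilon> c)\<^sup>2 * (C * K)"
    if c: "c \<in> {m_eps p \<epsilon>..M_eps p \<epsilon>}" for c
  proof -
    have sub: "ball x (gamma p CARD('n) * rad2 p \<epsilon> c) \<subseteq> ball x r"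
      using bi c by (auto simp: balls_inside_def)
    \<comment> \<open>By the definition of \<open>gamma\<close>, half of its square is p + d. This
      is the origin of the constant \<open>C\<close>.\<close>
    have eq: "1/2 * K * (gamma p CARD('n) * rad2 p \<epsilon> c)\<^sup>2 = (rad2 p \<epsilon> c)\<^sup>2 * (C * K)"
      using p by (simp add: power_mult_distrib gamma_def C_def)
    have zero: "normalized_p_lap p (grad f x) 0 = 0" by (simp add: normalized_p_lap_def trace_def)
    have "\<bar>M_op p (rad2 p \<epsilon> c) f x - (f x + (rad2 p \<epsilon> c)\<^sup>2 * normalized_p_lap p (grad f x) 0)\<bar>
      \<le> 1/2 * K * (gamma p CARD('n) * rad2 p \<epsilon> c)\<^sup>2
        + (gamma p CARD('n) * rad2 p \<epsilon> c) ^ 3 * (norm (0::real^'n^'n))\<^sup>2 / (2 * norm (grad f x))"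
      using K sub by (intro rad2_approx[OF p \<epsilon> f r(2) bi c]) auto
    then show ?thesis unfolding eq zero by simp
  qed
  have mono: "?h (- N) \<le> ?h (C * K)" "?h N \<le> ?h (C * K)"
    using N by (auto intro!: envelope_min_mono alpha_less_1 p)
  note bound = abs_A_op_error_le[where p = p and f = f and x = x, folded N_def G_def, OF p \<epsilon> f r bi K]
  have "\<bar>A_op_error p f x \<epsilon>\<bar> \<le> 2 * ?h (C * K) / 2 + \<epsilon> powr (2 / (3 * p - 4)) * G
      + \<epsilon> powr (2 - 4 / p) * (C * K + K / 2) + 0"
  proof (rule bound[where ?N1.0 = "- (C * K)" and ?N2.0 = "C * K"])
    show "?h (C * K) - ?h N + (?h (- N) - ?h (- (C * K))) \<le> 2 * ?h (C * K)"
      using mono envelope_min_nonneg[of "alpha p" G N] envelope_min_nonneg[of "alpha p" G "- (C * K)"]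
      by linarith
    show "?h N - ?h (- (C * K)) + (?h (- (- (C * K))) - ?h (- N)) \<le> 2 * ?h (C * K)"
      using mono envelope_min_nonneg[of "alpha p" G "- N"] envelope_min_nonneg[of "alpha p" G "- (C * K)"]
      by simp
  qed (use M C K0 in \<open>auto simp: abs_le_iff algebra_simps\<close>)
  also have "?h (C * K) = C powr (1 / (p - 1)) * (K powr (1 / (p - 1)) * G powr ((p - 2) / (p - 1)))"
    using C K0 p by (simp add: envelope_min_def one_minus_alpha powr_mult max_absorb2) (simp add: alpha_def)
  finally have "\<bar>A_op_error p f x \<epsilon>\<bar> \<le>
      C powr (1 / (p - 1)) * (K powr (1 / (p - 1)) * G powr ((p - 2) / (p - 1)))
      + (C + 1/2) * (\<epsilon> powr (2 - 4 / p) * K) + 1 * (\<epsilon> powr (2 / (3 * p - 4)) * G)"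
    by (simp add: algebra_simps)
  also have "\<dots> \<le> (C powr (1 / (p - 1)) + C + 1) * (K powr (1 / (p - 1)) * G powr ((p - 2) / (p - 1)))
      + (C powr (1 / (p - 1)) + C + 1) * (\<epsilon> powr (2 - 4 / p) * K)
      + (C powr (1 / (p - 1)) + C + 1) * (\<epsilon> powr (2 / (3 * p - 4)) * G)"
    using C K0 by (intro add_mono mult_right_mono) (auto simp: G_def add_increasing)
  finally show ?thesis by (simp add: G_def distrib_left)
qed

text \<open>The Lipschitz bound for the Hessian makes the averaging error cubic in the radius, so
  \<open>N1 = N2 = N\<close> and \<open>\<Delta>\<close> is 0. The remaining gradient and Hessian
  terms are the costs of the two cutoffs together with the sup and inf errors.\<close>

lemma A_op_error_bound_C3:
  fixes f :: "real^'n::finite \<Rightarrow> real"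
  assumes p: "2 < p" and \<epsilon>: "0 < \<epsilon>" "\<epsilon> < 1" and f: "Ck_on 3 (ball x R) f"
    and r: "0 < r" "r < R" and bi: "balls_inside p \<epsilon> x r" and g: "grad f x \<noteq> 0"
    and K1: "norm (grad f x) \<le> K1"
    and K2: "\<And>y. y \<in> ball x r \<Longrightarrow> norm (D2 f y) \<le> K2"
    and K3: "\<And>y. y \<in> ball x r \<Longrightarrow> norm (D3 f y) \<le> K3"
  shows "\<bar>A_op_error p f x \<epsilon>\<bar> \<le> (p + CARD('n) + 1) * \<epsilon> powr (2 - 4 / p) * K2
    + (1 + gamma p CARD('n) ^ 3) * \<epsilon> powr (2 / (3 * p - 4)) *
      (K1 + K3 + (norm (D2 f x))\<^sup>2 / norm (grad f x))"
proof -
  have f2: "Ck_on 2 (ball x R) f" using Ck_on_Suc_imp[of 2 "ball x R" f] f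
    by (simp only: numeral_3_eq_3 numeral_2_eq_2)
  define G where "G = norm (grad f x)"
  define N where "N = normalized_p_lap p (grad f x) (D2 f x)"
  define C where "C = p + real CARD('n)"
  define H where "H = norm (D2 f x)"
  define \<gamma> where "\<gamma> = gamma p CARD('n)"
  define q where "q = \<epsilon> powr (2 / (3 * p - 4))"
  have G: "0 < G" using g by (simp add: G_def)
  have C: "0 < C" using p by (simp add: C_def)
  have \<gamma>: "0 < \<gamma>" using gamma_pos[OF p] by (simp add: \<gamma>_def)
  have q: "0 \<le> q" by (simp add: q_def)
  have Hx: "H \<le> K2" "0 \<le> H" using K2 r by (simp_all add: H_def)
  have "norm (D3 f x) \<le> K3" using K3 r by simp
  then have K30: "0 \<le> K3" using norm_ge_zero[of "D3 f x"] by linarith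
  have N: "\<bar>N\<bar> \<le> C * H" unfolding N_def C_def H_def by (rule abs_normalized_p_lap_le[OF p])
  define e where "e = \<gamma> ^ 3 * q * (1/2 * K3 + H\<^sup>2 / (2 * G))"
  have e: "0 \<le> e" using \<gamma> q K30 G by (simp add: e_def)
  have M: "\<bar>M_op p (rad2 p \<epsilon> c) f x - (f x + (rad2 p \<epsilon> c)\<^sup>2 * N)\<bar> \<le> \<epsilon>\<^sup>2 * e"
    if c: "c \<in> {m_eps p \<epsilon>..M_eps p \<epsilon>}" for c
  proof -
    define s where "s = \<gamma> * rad2 p \<epsilon> c"
    have s: "0 < s" using \<gamma> rad_pos(2)[OF \<epsilon>(1) c] by (simp add: s_def)
    have sub: "ball x s \<subseteq> ball x r"
      using bi c by (auto simp: balls_inside_def s_def \<gamma>_def)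
    have subR: "ball x s \<subseteq> ball x R" by (rule order_trans[OF sub]) (use r in auto)
    have w: "norm (D2 f y - D2 f x) \<le> K3 * s" if y: "y \<in> ball x s" for y
    proof -
      have "norm (D2 f y - D2 f x) \<le> K3 * norm (y - x)"
        using K3 sub by (intro norm_D2_diff_le[OF f subR y]) auto
      also have "\<dots> \<le> K3 * s"
        using y K30 by (intro mult_left_mono) (auto simp: dist_norm norm_minus_commute)
      finally show ?thesis .
    qed
    have "\<bar>M_op p (rad2 p \<epsilon> c) f x - (f x + (rad2 p \<epsilon> c)\<^sup>2 * N)\<bar>
      \<le> 1/2 * (K3 * s) * s\<^sup>2 + s ^ 3 * H\<^sup>2 / (2 * G)"
      unfolding N_def s_def \<gamma>_def H_def G_def
      by (rule rad2_approx[OF p \<epsilon> f2 r(2) bi c]) (use w g in \<open>auto simp: s_def \<gamma>_def\<close>)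
    also have "\<dots> = rad2 p \<epsilon> c ^ 3 * (\<gamma> ^ 3 * (1/2 * K3 + H\<^sup>2 / (2 * G)))"
      by (simp add: s_def power_mult_distrib power2_eq_square power3_eq_cube algebra_simps)
    also have "\<dots> \<le> (\<epsilon>\<^sup>2 * q) * (\<gamma> ^ 3 * (1/2 * K3 + H\<^sup>2 / (2 * G)))"
      unfolding q_def using \<gamma> K30 G by (intro mult_right_mono rad2_cube_le[OF p \<epsilon>(1) c]) auto
    finally show ?thesis by (simp add: e_def mult_ac)
  qed
  have "\<bar>A_op_error p f x \<epsilon>\<bar> \<le> 0 / 2 + \<epsilon> powr (2 / (3 * p - 4)) * norm (grad f x)
      + \<epsilon> powr (2 - 4 / p) * (C * H + K2 / 2) + e"
    by (rule abs_A_op_error_le[OF p \<epsilon> f2 r bi K2 e, where ?N1.0 = N and ?N2.0 = N])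
      (use M N C Hx in \<open>auto simp: abs_le_iff N_def[symmetric] algebra_simps\<close>)
  also have "C * H \<le> C * K2" using C Hx by simp
  finally have "\<bar>A_op_error p f x \<epsilon>\<bar> \<le> q * G + \<epsilon> powr (2 - 4 / p) * (C * K2 + K2 / 2) + e"
    by (simp add: q_def G_def mult_left_mono)
  also have "\<epsilon> powr (2 - 4 / p) * (C * K2 + K2 / 2) \<le> \<epsilon> powr (2 - 4 / p) * ((C + 1) * K2)"
    using Hx by (intro mult_left_mono) (auto simp: algebra_simps)
  also have "q * G \<le> q * K1" using K1 q by (intro mult_left_mono) (auto simp: G_def)
  also have "e \<le> \<gamma> ^ 3 * q * (K1 + (K3 + H\<^sup>2 / G))"
    unfolding e_def
  proof (rule mult_left_mono)
    have "H\<^sup>2 / (2 * G) = H\<^sup>2 / G / 2" "0 \<le> H\<^sup>2 / G" "0 \<le> K1"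
      using G order_trans[OF norm_ge_zero K1] by auto
    then show "1/2 * K3 + H\<^sup>2 / (2 * G) \<le> K1 + (K3 + H\<^sup>2 / G)" using K30 by linarith
  qed (use \<gamma> q in simp)
  also have "q * K1 \<le> q * (K1 + (K3 + H\<^sup>2 / G))" using q K30 G by (intro mult_left_mono) auto
  finally show ?thesis
    by (simp add: C_def q_def H_def G_def \<gamma>_def algebra_simps)
qed

text \<open>The order of choices is: a shift \<open>\<delta>\<close> of N, then a closeness
  \<open>\<eta>\<close> of Hessians, then a radius \<open>r\<close>, and only then
  \<open>\<epsilon>\<close>. Critical points are treated separately, because the cubic remainder
  divides by the gradient.\<close>

lemma tendsto_A_op_error:
  fixes f :: "real^'n::finite \<Rightarrow> real"
  assumes p: "2 < p" and R: "0 < R" and f: "Ck_on 2 (ball x R) f"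
  shows "(A_op_error p f x \<longlongrightarrow> 0) (at_right 0)"
proof -
  define G where "G = norm (grad f x)"
  define N where "N = normalized_p_lap p (grad f x) (D2 f x)"
  define H where "H = norm (D2 f x)"
  define \<gamma> where "\<gamma> = gamma p CARD('n)"
  let ?h = "envelope_min (alpha p) G"
  have \<gamma>: "0 < \<gamma>" using gamma_pos[OF p] by (simp add: \<gamma>_def)
  define K where "K = Linf_norm (ball x (R / 2)) (D2 f)"
  have K: "norm (D2 f y) \<le> K" if "y \<in> ball x r" "r \<le> R / 2" for y r
    using norm_le_Linf_norm[OF continuous_on_D2[OF f], of "R / 2" y] R that by (auto simp: K_def)
  have ev: "\<forall>\<^sub>F \<epsilon>::real in at_right 0. 0 < \<epsilon> \<and> \<epsilon> < 1"
    using eventually_at_right_real[of 0 "1::real"] by (auto elim: eventually_mono)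
  have ev0: "\<forall>\<^sub>F \<epsilon>::real in at_right 0. 0 \<le> \<epsilon>"
    using ev by eventually_elim simp
  have lim: "((\<lambda>\<epsilon>::real. \<epsilon> powr (2 / (3 * p - 4))) \<longlongrightarrow> 0) (at_right 0)"
      "((\<lambda>\<epsilon>::real. \<epsilon> powr (2 - 4 / p)) \<longlongrightarrow> 0) (at_right 0)"
    using p by (auto intro!: tendsto_zero_powrI[where f = "\<lambda>x. x"] tendsto_intros ev0 simp: field_simps)
  show ?thesis
  proof (cases "grad f x = 0")
    case True
    define C where "C = p + real CARD('n)"
    \<comment> \<open>With zero gradient the first and last terms of the crude bound vanish, the
      first because \<open>0 powr q = 0\<close>.\<close>
    have "\<forall>\<^sub>F \<epsilon> in at_right 0. norm (A_op_error p f x \<epsilon>) \<le>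
        (C powr (1 / (p - 1)) + C + 1) * (\<epsilon> powr (2 - 4 / p) * K)"
      using ev eventually_balls_inside[OF p half_gt_zero[OF R], of x]
    proof eventually_elim
      case (elim \<epsilon>)
      then show ?case
        using A_op_error_bound_crude[OF p _ _ f _ _ elim(2) K[of _ "R / 2"]] R True
        by (simp add: C_def)
    qed
    moreover have "((\<lambda>\<epsilon>. (C powr (1 / (p - 1)) + C + 1) * (\<epsilon> powr (2 - 4 / p) * K)) \<longlongrightarrow> 0) (at_right 0)"
      by (intro tendsto_mult_right_zero tendsto_mult_left_zero lim)
    ultimately show ?thesis by (rule Lim_null_comparison)
  next
    case False
    then have G: "0 < G" by (simp add: G_def)
    show ?thesis
      unfolding tendsto_iff
    proof (intro allI impI)
      fix \<tau> :: real assume \<tau>: "0 < \<tau>"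
      \<comment> \<open>The sum of the two variations required to be at most
        \<open>\<Delta>\<close>. Each is nonnegative by monotonicity, so \<open>D \<delta>\<close>
        bounds both.\<close>
      define D where "D \<delta> = (?h (N + \<delta>) - ?h N + (?h (- N) - ?h (- (N + \<delta>))))
        + (?h N - ?h (N - \<delta>) + (?h (- (N - \<delta>)) - ?h (- N)))" for \<delta>
      have hc: "(\<phi> \<longlongrightarrow> a) (at_right 0) \<Longrightarrow> ((\<lambda>\<delta>. ?h (\<phi> \<delta>)) \<longlongrightarrow> ?h a) (at_right 0)"
        for \<phi> :: "real \<Rightarrow> real" and a
        by (rule isCont_tendsto_compose[OF isCont_envelope_min[OF alpha_less_1[OF p]]])
      have "(D \<longlongrightarrow> (?h (N + 0) - ?h N + (?h (- N) - ?h (- (N + 0))))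
        + (?h N - ?h (N - 0) + (?h (- (N - 0)) - ?h (- N)))) (at_right 0)"
        unfolding D_def by (intro tendsto_add tendsto_diff hc tendsto_minus tendsto_const tendsto_ident_at)
      then have "(D \<longlongrightarrow> 0) (at_right 0)" by simp
      then have "\<forall>\<^sub>F \<delta> in at_right 0. D \<delta> < \<tau>" using \<tau> by (rule order_tendstoD)
      then have "\<forall>\<^sub>F \<delta> in at_right 0. D \<delta> < \<tau> \<and> 0 < \<delta>" using eventually_at_right_less by eventually_elim simp
      then obtain \<delta> where \<delta>: "D \<delta> < \<tau>" "0 < \<delta>"
        using eventually_happens trivial_limit_at_right_real by blast
      have mono: "?h a \<le> ?h b" if "a \<le> b" for a b
        by (rule envelope_min_mono[OF alpha_less_1[OF p] that])
      have D12: "?h (N + \<delta>) - ?h N + (?h (- N) - ?h (- (N + \<delta>))) \<le> D \<delta>"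
        "?h N - ?h (N - \<delta>) + (?h (- (N - \<delta>)) - ?h (- N)) \<le> D \<delta>"
        unfolding D_def using \<delta>(2) mono[of N "N + \<delta>"] mono[of "- (N + \<delta>)" "- N"]
          mono[of "N - \<delta>" N] mono[of "- N" "- (N - \<delta>)"] by simp_all
      \<comment> \<open>The Taylor error and the cubic remainder will each be at most half of
        \<open>\<eta>\<close> times the squared averaging radius. The factor \<gamma>^2 converts
        that radius to \<open>rad2\<close>, leaving the multiple
        \<open>\<delta> / 2\<close>.\<close>
      define \<eta> where "\<eta> = \<delta> / (2 * \<gamma>\<^sup>2)"
      have \<eta>: "0 < \<eta>" using \<delta> \<gamma> by (simp add: \<eta>_def)
      have "isCont (D2 f) x"
        using continuous_on_D2[OF f] R by (simp add: continuous_on_eq_continuous_at)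
      then obtain r1 where r1: "0 < r1" "\<And>y. dist y x < r1 \<Longrightarrow> dist (D2 f y) (D2 f x) < \<eta>"
        using \<eta> unfolding continuous_at_eps_delta by (metis dist_commute)
      \<comment> \<open>The last entry gives \<open>r * H\<^sup>2 / G \<le> \<eta>\<close>, which
        turns the cubic remainder into a small quadratic one. Adding 1 keeps the denominator
        positive when the Hessian vanishes.\<close>
      define r where "r = min (min r1 (R / 2)) (\<eta> * G / (H\<^sup>2 + 1))"
      have h1: "0 < H\<^sup>2 + 1" by (simp add: add_nonneg_pos)
      have r: "0 < r" "r \<le> r1" "r \<le> R / 2" "r \<le> \<eta> * G / (H\<^sup>2 + 1)"
        using r1 R \<eta> G h1 by (simp_all only: r_def min_less_iff_conj min_le_iff_disj order_refl simp_thms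
          divide_pos_pos mult_pos_pos half_gt_zero)
      have rH: "r * H\<^sup>2 / G \<le> \<eta>"
      proof -
        have "r * H\<^sup>2 \<le> r * (H\<^sup>2 + 1)" using r by simp
        also have "\<dots> \<le> \<eta> * G" using r(4) h1 by (simp add: field_simps)
        finally show ?thesis using G by (simp add: field_simps)
      qed
      have "((\<lambda>\<epsilon>. \<epsilon> powr (2 / (3 * p - 4)) * G + \<epsilon> powr (2 - 4 / p) * (\<bar>N\<bar> + \<delta> + K / 2)) \<longlongrightarrow> 0 + 0) (at_right 0)"
        by (intro tendsto_add tendsto_mult_left_zero lim)
      then have "((\<lambda>\<epsilon>. \<epsilon> powr (2 / (3 * p - 4)) * G + \<epsilon> powr (2 - 4 / p) * (\<bar>N\<bar> + \<delta> + K / 2)) \<longlongrightarrow> 0) (at_right 0)"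
        by simp
      then have "\<forall>\<^sub>F \<epsilon> in at_right 0. \<epsilon> powr (2 / (3 * p - 4)) * G + \<epsilon> powr (2 - 4 / p) * (\<bar>N\<bar> + \<delta> + K / 2) < \<tau> / 2"
        using \<tau> by (intro order_tendstoD) auto
      with ev eventually_balls_inside[OF p r(1), of x]
      show "\<forall>\<^sub>F \<epsilon> in at_right 0. dist (A_op_error p f x \<epsilon>) 0 < \<tau>"
      proof eventually_elim
        case (elim \<epsilon>)
        then have \<epsilon>: "0 < \<epsilon>" "\<epsilon> < 1" and bi: "balls_inside p \<epsilon> x r" by auto
        have rR: "r < R" using r R by simp
        have M: "\<bar>M_op p (rad2 p \<epsilon> c) f x - (f x + (rad2 p \<epsilon> c)\<^sup>2 * N)\<bar> \<le> (rad2 p \<epsilon> c)\<^sup>2 * \<delta>"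
          if c: "c \<in> {m_eps p \<epsilon>..M_eps p \<epsilon>}" for c
        proof -
          define s where "s = \<gamma> * rad2 p \<epsilon> c"
          have s: "0 < s" using \<gamma> rad_pos(2)[OF \<epsilon>(1) c] by (simp add: s_def)
          have sub: "ball x s \<subseteq> ball x r"
            using bi c by (auto simp: balls_inside_def s_def \<gamma>_def)
          then have sr: "s \<le> r" using s by (simp add: ball_subset_ball_iff)
          have w: "norm (D2 f y - D2 f x) \<le> \<eta>" if y: "y \<in> ball x s" for y
            using r1(2)[of y] y sr r by (auto simp: dist_norm norm_minus_commute intro: less_imp_le)
          have "\<bar>M_op p (rad2 p \<epsilon> c) f x - (f x + (rad2 p \<epsilon> c)\<^sup>2 * N)\<bar>
            \<le> 1/2 * \<eta> * s\<^sup>2 + s ^ 3 * H\<^sup>2 / (2 * G)"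
            unfolding N_def s_def \<gamma>_def H_def G_def
            by (rule rad2_approx[OF p \<epsilon> f rR bi c]) (use w False in \<open>auto simp: s_def \<gamma>_def\<close>)
          also have "s ^ 3 * H\<^sup>2 / (2 * G) = 1/2 * s\<^sup>2 * (s * H\<^sup>2 / G)"
            by (simp add: power2_eq_square power3_eq_cube)
          also have "\<dots> \<le> 1/2 * s\<^sup>2 * \<eta>"
          proof (rule mult_left_mono)
            have "s * H\<^sup>2 / G \<le> r * H\<^sup>2 / G" using sr G by (intro divide_right_mono mult_right_mono) auto
            then show "s * H\<^sup>2 / G \<le> \<eta>" using rH by linarith
          qed simp
          also have "1/2 * \<eta> * s\<^sup>2 + 1/2 * s\<^sup>2 * \<eta> = \<eta> * s\<^sup>2" by simp
          also have "\<dots> = (rad2 p \<epsilon> c)\<^sup>2 * (\<delta> / 2)"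
            using \<gamma> by (simp add: s_def \<eta>_def power_mult_distrib field_simps)
          also have "\<dots> \<le> (rad2 p \<epsilon> c)\<^sup>2 * \<delta>" using \<delta> by (intro mult_left_mono) auto
          finally show ?thesis by simp
        qed
        \<comment> \<open>The error is put entirely into the shift of N, with 0 as the additive
          part, because \<open>(rad2 p \<epsilon> c)\<^sup>2 * \<delta>\<close> need not be small
          relative to \<open>\<epsilon>\<^sup>2\<close> for small \<open>c\<close>.\<close>
        have M12: "f x + (rad2 p \<epsilon> c)\<^sup>2 * (N - \<delta>) - \<epsilon>\<^sup>2 * 0 \<le> M_op p (rad2 p \<epsilon> c) f x"
          "M_op p (rad2 p \<epsilon> c) f x \<le> f x + (rad2 p \<epsilon> c)\<^sup>2 * (N + \<delta>) + \<epsilon>\<^sup>2 * 0"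
          if "c \<in> {m_eps p \<epsilon>..M_eps p \<epsilon>}" for c
          using M[OF that] by (simp_all add: abs_le_iff algebra_simps)
        have "\<bar>A_op_error p f x \<epsilon>\<bar> \<le> D \<delta> / 2 + \<epsilon> powr (2 / (3 * p - 4)) * norm (grad f x)
          + \<epsilon> powr (2 - 4 / p) * (\<bar>N\<bar> + \<delta> + K / 2) + 0"
          unfolding G_def[symmetric]
          by (rule abs_A_op_error_le[where p = p and f = f and x = x, folded N_def G_def, OF p \<epsilon> f r(1) rR bi
            K[OF _ r(3)] order_refl M12 D12])
            (use \<delta> in auto)
        then show ?case using elim(3) \<delta>(1) by (simp add: G_def)
      qed
    qed
  qed
qed

text \<open>The constants precede \<open>x\<close> and \<open>R\<close>, so they depend only on
  \<open>p\<close> and the dimension. The norms are taken over balls of radius \<open>r\<close>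
  since averaging balls can be larger than \<epsilon>, and for \<open>\<epsilon>\<close> close to
  \<open>\<epsilon>b\<close> they leave the ball of radius \<open>\<epsilon>b\<close>. Some
  \<open>r\<close> works for all \<open>\<epsilon> < \<epsilon>b\<close>, and
  \<open>r = \<epsilon>b\<close> itself is admissible as soon as \<open>\<epsilon>\<close> is small
  enough.\<close>

theorem theorem2p4:
  fixes p :: real
  assumes "p > 2"
  shows "\<exists>k1>0. \<exists>k2>0. \<exists>k3>0. \<forall>(x::real^'n::finite) R. 0 < R \<and> R < 1 \<longrightarrow>
    (\<exists>\<epsilon>b. 0 < \<epsilon>b \<and> \<epsilon>b < R \<and>
      (\<forall>\<epsilon>. 0 < \<epsilon> \<and> \<epsilon> < \<epsilon>b \<longrightarrow>
        (\<forall>\<phi>. \<phi> \<in> borel_measurable (lebesgue_on (ball x R)) \<and> bounded (\<phi> ` ball x R) \<longrightarrow>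
          A_well_defined p \<epsilon> \<phi> x R)) \<and>
      (\<exists>r. \<epsilon>b \<le> r \<and> r < R \<and> (\<forall>\<epsilon>. 0 < \<epsilon> \<and> \<epsilon> < \<epsilon>b \<longrightarrow> balls_inside p \<epsilon> x r)) \<and>
      (\<forall>\<^sub>F \<epsilon> in at_right 0. balls_inside p \<epsilon> x \<epsilon>b) \<and>
      (\<forall>\<phi>. Ck_on 2 (ball x R) \<phi> \<longrightarrow>
        (\<exists>E :: real \<Rightarrow> real.
          (\<forall>\<epsilon>. 0 < \<epsilon> \<and> \<epsilon> < \<epsilon>b \<longrightarrow>
            A_well_defined p \<epsilon> \<phi> x R \<and>
            A_op p \<epsilon> \<phi> x =
              \<phi> x + \<epsilon>\<^sup>2 / 2 * spow (p_laplacian p \<phi> x) (1 / (p - 1)) + \<epsilon>\<^sup>2 * E \<epsilon>) \<and>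
          (E \<longlongrightarrow> 0) (at_right 0) \<and>
          (Ck_on 3 (ball x R) \<phi> \<and> grad \<phi> x \<noteq> 0 \<longrightarrow>
            (\<forall>\<epsilon> r. 0 < \<epsilon> \<and> \<epsilon> < \<epsilon>b \<and> \<epsilon>b \<le> r \<and> r < R \<and> balls_inside p \<epsilon> x r \<longrightarrow>
              \<bar>E \<epsilon>\<bar> \<le> k1 * \<epsilon> powr (2 - 4 / p) * Linf_norm (ball x r) (D2 \<phi>)
                + k2 * \<epsilon> powr (2 / (3 * p - 4)) *
                    (Linf_norm (ball x r) (grad \<phi>) + Linf_norm (ball x r) (D3 \<phi>)
                     + (norm (D2 \<phi> x))\<^sup>2 / norm (grad \<phi> x)))) \<and>
          (\<forall>\<epsilon> r. 0 < \<epsilon> \<and> \<epsilon> < \<epsilon>b \<and> \<epsilon>b \<le> r \<and> r < R \<and> balls_inside p \<epsilon> x r \<longrightarrow>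
            \<bar>E \<epsilon>\<bar> \<le> k3 *
              (Linf_norm (ball x r) (D2 \<phi>) powr (1 / (p - 1))
                 * norm (grad \<phi> x) powr ((p - 2) / (p - 1))
               + \<epsilon> powr (2 - 4 / p) * Linf_norm (ball x r) (D2 \<phi>)
               + \<epsilon> powr (2 / (3 * p - 4)) * norm (grad \<phi> x))))))"
proof -
  define C where "C = p + real CARD('n)"
  define k3 where "k3 = C powr (1 / (p - 1)) + C + 1"
  define k2 where "k2 = 1 + gamma p CARD('n) ^ 3"
  have C: "0 < C" using assms by (simp add: C_def)
  have k: "0 < C + 1" "0 < k2" "0 < k3"
    using C gamma_pos[OF assms, of "CARD('n)"] by (auto simp: k2_def k3_def add_nonneg_pos add_pos_pos)
  have "\<exists>\<epsilon>b. 0 < \<epsilon>b \<and> \<epsilon>b < R \<and>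
      (\<forall>\<epsilon>. 0 < \<epsilon> \<and> \<epsilon> < \<epsilon>b \<longrightarrow>
        (\<forall>\<phi>. \<phi> \<in> borel_measurable (lebesgue_on (ball x R)) \<and> bounded (\<phi> ` ball x R) \<longrightarrow>
          A_well_defined p \<epsilon> \<phi> x R)) \<and>
      (\<exists>r. \<epsilon>b \<le> r \<and> r < R \<and> (\<forall>\<epsilon>. 0 < \<epsilon> \<and> \<epsilon> < \<epsilon>b \<longrightarrow> balls_inside p \<epsilon> x r)) \<and>
      (\<forall>\<^sub>F \<epsilon> in at_right 0. balls_inside p \<epsilon> x \<epsilon>b) \<and>
      (\<forall>\<phi>. Ck_on 2 (ball x R) \<phi> \<longrightarrow>
        (\<exists>E :: real \<Rightarrow> real.
          (\<forall>\<epsilon>. 0 < \<epsilon> \<and> \<epsilon> < \<epsilon>b \<longrightarrow>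
            A_well_defined p \<epsilon> \<phi> x R \<and>
            A_op p \<epsilon> \<phi> x =
              \<phi> x + \<epsilon>\<^sup>2 / 2 * spow (p_laplacian p \<phi> x) (1 / (p - 1)) + \<epsilon>\<^sup>2 * E \<epsilon>) \<and>
          (E \<longlongrightarrow> 0) (at_right 0) \<and>
          (Ck_on 3 (ball x R) \<phi> \<and> grad \<phi> x \<noteq> 0 \<longrightarrow>
            (\<forall>\<epsilon> r. 0 < \<epsilon> \<and> \<epsilon> < \<epsilon>b \<and> \<epsilon>b \<le> r \<and> r < R \<and> balls_inside p \<epsilon> x r \<longrightarrow>
              \<bar>E \<epsilon>\<bar> \<le> (C + 1) * \<epsilon> powr (2 - 4 / p) * Linf_norm (ball x r) (D2 \<phi>)
                + k2 * \<epsilon> powr (2 / (3 * p - 4)) *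
                    (Linf_norm (ball x r) (grad \<phi>) + Linf_norm (ball x r) (D3 \<phi>)
                     + (norm (D2 \<phi> x))\<^sup>2 / norm (grad \<phi> x)))) \<and>
          (\<forall>\<epsilon> r. 0 < \<epsilon> \<and> \<epsilon> < \<epsilon>b \<and> \<epsilon>b \<le> r \<and> r < R \<and> balls_inside p \<epsilon> x r \<longrightarrow>
            \<bar>E \<epsilon>\<bar> \<le> k3 *
              (Linf_norm (ball x r) (D2 \<phi>) powr (1 / (p - 1))
                 * norm (grad \<phi> x) powr ((p - 2) / (p - 1))
               + \<epsilon> powr (2 - 4 / p) * Linf_norm (ball x r) (D2 \<phi>)
               + \<epsilon> powr (2 / (3 * p - 4)) * norm (grad \<phi> x)))))"
    if R: "0 < R" "R < 1" for x :: "real^'n" and R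
  proof -
    obtain \<delta> where \<delta>: "0 < \<delta>" "\<And>\<epsilon>. 0 < \<epsilon> \<Longrightarrow> \<epsilon> < \<delta> \<Longrightarrow> balls_inside p \<epsilon> x (R / 2)"
      using eventually_balls_inside[OF assms half_gt_zero[OF R(1)], of x]
      unfolding eventually_at_right_field by auto
    \<comment> \<open>The radius R/2 keeps a positive distance from the boundary, where the
      derivatives of \<open>\<phi>\<close> may blow up. Capping \<open>\<epsilon>b\<close> by it
      makes \<open>r = R / 2\<close> a common witness for all \<open>\<epsilon>\<close>.\<close>
    define \<epsilon>b where "\<epsilon>b = min \<delta> (R / 2)"
    have eb: "0 < \<epsilon>b" "\<epsilon>b \<le> R / 2" "\<epsilon>b < R" "\<epsilon>b < 1" using \<delta>(1) R by (auto simp: \<epsilon>b_def min_def)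
    have bi: "balls_inside p \<epsilon> x (R / 2)" if "0 < \<epsilon>" "\<epsilon> < \<epsilon>b" for \<epsilon>
      using \<delta>(2) that by (simp add: \<epsilon>b_def)
    have half: "ball x (R / 2) \<subseteq> ball x R" using R by auto
    show ?thesis
    proof (rule exI[of _ \<epsilon>b], intro conjI allI impI; (elim conjE)?)
      show "0 < \<epsilon>b" "\<epsilon>b < R" using eb by auto
      fix \<epsilon> :: real and \<phi> :: "real^'n \<Rightarrow> real"
      assume "0 < \<epsilon>" "\<epsilon> < \<epsilon>b"
        "\<phi> \<in> borel_measurable (lebesgue_on (ball x R))" "bounded (\<phi> ` ball x R)"
      moreover from bi have "balls_inside p \<epsilon> x R"
        using half \<open>0 < \<epsilon>\<close> \<open>\<epsilon> < \<epsilon>b\<close> unfolding balls_inside_def by blast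
      ultimately show "A_well_defined p \<epsilon> \<phi> x R"
        using eb by (intro A_well_definedI[OF assms]) auto
    next
      show "\<exists>r\<ge>\<epsilon>b. r < R \<and> (\<forall>\<epsilon>. 0 < \<epsilon> \<and> \<epsilon> < \<epsilon>b \<longrightarrow> balls_inside p \<epsilon> x r)"
        using eb bi R by (intro exI[of _ "R / 2"]) auto
      show "\<forall>\<^sub>F \<epsilon> in at_right 0. balls_inside p \<epsilon> x \<epsilon>b"
        by (rule eventually_balls_inside[OF assms eb(1)])
    next
      fix \<phi> :: "real^'n \<Rightarrow> real"
      assume \<phi>: "Ck_on 2 (ball x R) \<phi>"
      have L2: "norm (D2 \<phi> y) \<le> Linf_norm (ball x r) (D2 \<phi>)" if "r < R" "y \<in> ball x r" for r y
        by (rule norm_le_Linf_norm[OF continuous_on_D2[OF \<phi>] that])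
      show "\<exists>E :: real \<Rightarrow> real.
          (\<forall>\<epsilon>. 0 < \<epsilon> \<and> \<epsilon> < \<epsilon>b \<longrightarrow>
            A_well_defined p \<epsilon> \<phi> x R \<and>
            A_op p \<epsilon> \<phi> x =
              \<phi> x + \<epsilon>\<^sup>2 / 2 * spow (p_laplacian p \<phi> x) (1 / (p - 1)) + \<epsilon>\<^sup>2 * E \<epsilon>) \<and>
          (E \<longlongrightarrow> 0) (at_right 0) \<and>
          (Ck_on 3 (ball x R) \<phi> \<and> grad \<phi> x \<noteq> 0 \<longrightarrow>
            (\<forall>\<epsilon> r. 0 < \<epsilon> \<and> \<epsilon> < \<epsilon>b \<and> \<epsilon>b \<le> r \<and> r < R \<and> balls_inside p \<epsilon> x r \<longrightarrow>
              \<bar>E \<epsilon>\<bar> \<le> (C + 1) * \<epsilon> powr (2 - 4 / p) * Linf_norm (ball x r) (D2 \<phi>)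
                + k2 * \<epsilon> powr (2 / (3 * p - 4)) *
                    (Linf_norm (ball x r) (grad \<phi>) + Linf_norm (ball x r) (D3 \<phi>)
                     + (norm (D2 \<phi> x))\<^sup>2 / norm (grad \<phi> x)))) \<and>
          (\<forall>\<epsilon> r. 0 < \<epsilon> \<and> \<epsilon> < \<epsilon>b \<and> \<epsilon>b \<le> r \<and> r < R \<and> balls_inside p \<epsilon> x r \<longrightarrow>
            \<bar>E \<epsilon>\<bar> \<le> k3 *
              (Linf_norm (ball x r) (D2 \<phi>) powr (1 / (p - 1))
                 * norm (grad \<phi> x) powr ((p - 2) / (p - 1))
               + \<epsilon> powr (2 - 4 / p) * Linf_norm (ball x r) (D2 \<phi>)
               + \<epsilon> powr (2 / (3 * p - 4)) * norm (grad \<phi> x)))"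
      proof (intro exI[of _ "A_op_error p \<phi> x"] conjI allI impI; (elim conjE)?)
        fix \<epsilon> :: real assume \<epsilon>: "0 < \<epsilon>" "\<epsilon> < \<epsilon>b"
        show "A_well_defined p \<epsilon> \<phi> x R"
          using Ck_on_2_A_well_defined[OF assms \<epsilon>(1) _ \<phi> _ bi[OF \<epsilon>]] \<epsilon> eb R by simp
        show "A_op p \<epsilon> \<phi> x =
            \<phi> x + \<epsilon>\<^sup>2 / 2 * spow (p_laplacian p \<phi> x) (1 / (p - 1)) + \<epsilon>\<^sup>2 * A_op_error p \<phi> x \<epsilon>"
          using \<epsilon> by (simp add: A_op_error_def field_simps)
      next
        show "(A_op_error p \<phi> x \<longlongrightarrow> 0) (at_right 0)"
          by (rule tendsto_A_op_error[OF assms R(1) \<phi>])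
      next
        fix \<epsilon> r :: real
        assume \<phi>3: "Ck_on 3 (ball x R) \<phi>" "grad \<phi> x \<noteq> 0"
          and *: "0 < \<epsilon>" "\<epsilon> < \<epsilon>b" "\<epsilon>b \<le> r" "r < R" "balls_inside p \<epsilon> x r"
        have r: "0 < r" "\<epsilon> < 1" using * eb by auto
        show "\<bar>A_op_error p \<phi> x \<epsilon>\<bar> \<le> (C + 1) * \<epsilon> powr (2 - 4 / p) * Linf_norm (ball x r) (D2 \<phi>)
                + k2 * \<epsilon> powr (2 / (3 * p - 4)) *
                    (Linf_norm (ball x r) (grad \<phi>) + Linf_norm (ball x r) (D3 \<phi>)
                     + (norm (D2 \<phi> x))\<^sup>2 / norm (grad \<phi> x))"
          unfolding C_def k2_def
        proof (rule A_op_error_bound_C3[OF assms *(1) r(2) \<phi>3(1) r(1) *(4,5) \<phi>3(2) _ L2[OF *(4)]])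
          show "norm (grad \<phi> x) \<le> Linf_norm (ball x r) (grad \<phi>)"
            using r by (intro norm_le_Linf_norm[OF continuous_on_grad[OF \<phi>] *(4)]) auto
        qed (auto intro: norm_le_Linf_norm[OF continuous_on_D3[OF \<phi>3(1)] *(4)])
      next
        fix \<epsilon> r :: real
        assume *: "0 < \<epsilon>" "\<epsilon> < \<epsilon>b" "\<epsilon>b \<le> r" "r < R" "balls_inside p \<epsilon> x r"
        have r: "0 < r" "\<epsilon> < 1" using * eb by auto
        show "\<bar>A_op_error p \<phi> x \<epsilon>\<bar> \<le> k3 *
              (Linf_norm (ball x r) (D2 \<phi>) powr (1 / (p - 1))
                 * norm (grad \<phi> x) powr ((p - 2) / (p - 1))
               + \<epsilon> powr (2 - 4 / p) * Linf_norm (ball x r) (D2 \<phi>)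
               + \<epsilon> powr (2 / (3 * p - 4)) * norm (grad \<phi> x))"
          unfolding k3_def C_def
          by (rule A_op_error_bound_crude[OF assms *(1) r(2) \<phi> r(1) *(4,5) L2[OF *(4)]])
      qed
    qed
  qed
  with k show ?thesis by blast
qed

end
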